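(* For $H > 1$, we have $$ H \ll \rho_2(H;\mathbb{Z}) \ll H, $$ and for $n\ge 3$ $$ \frac{H}{(\log H)^{C_0(n)}} \ll \rho_n(H;\mathbb{Z}) \ll H\, \frac {(\log\log H)^{n-1}}{(\log H)^{n-2}}, $$ where $C_0(n)$ is a positive number which is effectively computable in terms of $n$.
   Context: Let $n\ge 2$ be an integer. A vector $\mathbf{v}=(v_1,\dots,v_n)$ with integer coordinates is multiplicatively dependent if all its coordinates are non-zero and there is a non-zero integer vector $(k_1,\dots,k_n)\in\mathbb{Z}^n$ with $v_1^{k_1}\cdots v_n^{k_n}=1$. $\mathcal{M}_n(\mathbb{Z})$ denotes the set of all multiplicatively dependent vectors in $\mathbb{Z}^n$. For $H>1$, $$ \rho_n(H;\mathbb{Z}) = \sup_{\substack{\mathbf{x} \in \mathbb{R}^n\\ \|\mathbf{x}\| \le H}}\ \inf_{\mathbf{v} \in \mathcal{M}_n(\mathbb{Z})} \|\mathbf{x} - \mathbf{v}\|, $$ where $\|\mathbf{x}\|=\sqrt{x_1^2+\cdots+x_n^2}$ is the Euclidean norm of $\mathbf{x}=(x_1,\dots,x_n)\in\mathbb{R}^n$. $U\ll V$ means $|U|\le cV$ for some positive number $c$ (the implied constant); the implied constants may depend on $n$.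
   Formalization: For n ≥ 3 the bounds fail uniformly in H > 1 (lower bound blows up as H→1, upper bound is 0 at H = e); they are stated for H ≥ H_0, with any H_0 > 1 for the lower and any H_0 > e for the upper bound, the implied constants depending on n and H_0. *)

theory Defs
  imports "HOL-Analysis.Analysis"
begin

text \<open>
  The dimension \<open>n\<close> is quantified inside the theorem, so vectors in \<open>R\<^sup>n\<close> and \<open>Z\<^sup>n\<close> are
  extensional functions on the index set \<open>{..<n}\<close>; the Euclidean norm is \<^const>\<open>L2_set\<close>.
\<close>

definition mult_dep :: "nat \<Rightarrow> (nat \<Rightarrow> int) set" where
  "mult_dep n = {v \<in> {..<n} \<rightarrow>\<^sub>E UNIV.
     (\<forall>i<n. v i \<noteq> 0) \<and>
     (\<exists>k \<in> {..<n} \<rightarrow>\<^sub>E (UNIV :: int set).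
        (\<exists>i<n. k i \<noteq> 0) \<and> (\<Prod>i<n. real_of_int (v i) powi k i) = 1)}"

definition rho :: "nat \<Rightarrow> real \<Rightarrow> real" where
  "rho n H = (SUP x \<in> {x \<in> {..<n} \<rightarrow>\<^sub>E (UNIV :: real set). L2_set x {..<n} \<le> H}.
                INF v \<in> mult_dep n. L2_set (\<lambda>i. x i - real_of_int (v i)) {..<n})"

text \<open>Vinogradov's \<open>f \<lless> g\<close>, with an implied constant uniform over the range \<open>S\<close>. For \<open>n \<ge> 3\<close> the
  bounds in terms of \<open>ln H\<close> and \<open>ln (ln H)\<close> cannot hold uniformly for all \<open>H > 1\<close>: the lower one
  blows up as \<open>H\<close> tends to \<open>1\<close>, and the upper one vanishes at \<open>H = exp 1\<close>. They are therefore stated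
  uniformly on \<open>{H\<^sub>0..}\<close> for every \<open>H\<^sub>0 > 1\<close> and every \<open>H\<^sub>0 > exp 1\<close>, respectively.\<close>

definition vinogradov_on :: "real set \<Rightarrow> (real \<Rightarrow> real) \<Rightarrow> (real \<Rightarrow> real) \<Rightarrow> bool" where
  "vinogradov_on S f g \<longleftrightarrow> (\<exists>c>0. \<forall>H\<in>S. \<bar>f H\<bar> \<le> c * g H)"

text \<open>
  Total \<open>\<mu>\<close>-recursive functions. In \<open>mu_recursive n f\<close> only the values of \<open>f\<close> on lists of
  length \<open>n\<close> are meaningful. Minimisation is applied to regular functions only, which by Kleene's
  normal form theorem still yields all total computable functions.
\<close>

inductive mu_recursive :: "nat \<Rightarrow> (nat list \<Rightarrow> nat) \<Rightarrow> bool" where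
  zero: "mu_recursive n (\<lambda>xs. 0)"
| succ: "mu_recursive 1 (\<lambda>xs. Suc (xs ! 0))"
| proj: "i < n \<Longrightarrow> mu_recursive n (\<lambda>xs. xs ! i)"
| comp: "mu_recursive (length gs) f \<Longrightarrow> (\<forall>g \<in> set gs. mu_recursive n g) \<Longrightarrow>
         mu_recursive n (\<lambda>xs. f (map (\<lambda>g. g xs) gs))"
| prim_rec: "mu_recursive n f \<Longrightarrow> mu_recursive (n + 2) g \<Longrightarrow>
         mu_recursive (n + 1)
           (\<lambda>xs. rec_nat (f (tl xs)) (\<lambda>m y. g (m # y # tl xs)) (hd xs))"
| minim: "mu_recursive (n + 1) f \<Longrightarrow> (\<forall>xs. length xs = n \<longrightarrow> (\<exists>m. f (m # xs) = 0)) \<Longrightarrow>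
         mu_recursive n (\<lambda>xs. LEAST m. f (m # xs) = 0)"

text \<open>
  \<open>C n\<close> is effectively computable in terms of \<open>n\<close>: one algorithm produces, from \<open>n\<close> and \<open>k\<close>, an
  integer \<open>p - q\<close> such that \<open>(p - q) / 2 ^ k\<close> approximates \<open>C n\<close> to within \<open>1 / 2 ^ k\<close>.
\<close>

definition effectively_computable :: "(nat \<Rightarrow> real) \<Rightarrow> bool" where
  "effectively_computable C \<longleftrightarrow>
     (\<exists>p q. mu_recursive 2 p \<and> mu_recursive 2 q \<and>
        (\<forall>n k. \<bar>C n - (real (p [n, k]) - real (q [n, k])) / 2 ^ k\<bar> \<le> 1 / 2 ^ k))"

end

theory Submission
  imports Defs "HOL-Computational_Algebra.Primes"
begin

text \<open>
  Lower bound for \<open>n \<ge> 3\<close>: a dependent vector \<open>v\<close> of size \<open>O(H)\<close> satisfies \<open>\<Sum> k i * ln \<bar>v i\<bar> = 0\<close> with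
  \<open>k \<noteq> 0\<close> bounded by some \<open>W\<close> that is polynomial in \<open>ln H\<close>, since the prime exponents of its
  coordinates are \<open>O(ln H)\<close>. The point with coordinates \<open>exp (\<tau> + W ^ i / W ^ n)\<close>, \<open>\<tau>\<close> a natural number, is far from
  all such \<open>v\<close> by uniqueness of base-\<open>W\<close> expansions. The degree of \<open>W\<close> does not
  matter, so the crude bound from Gaussian elimination is enough.

  Upper bound for \<open>n \<ge> 3\<close>: \<open>n\<close> products of powers of the same \<open>n - 1\<close> integers are dependent. The \<open>n - 1\<close>
  integers are chosen in terms of \<open>H\<close> so that these products are dense near \<open>H\<close>.

  For \<open>n = 2\<close> the coordinates of a dependent vector other than \<open>\<plusminus>1\<close> are powers of one integer up
  to sign, so they are equal in absolute value or differ by a factor of at least \<open>2\<close>; the point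
  \<open>(2 t, 3 t)\<close> is far from all of these.
\<close>

section \<open>Integer relations\<close>

text \<open>One step of fraction-free Gaussian elimination with pivot \<open>a i p\<close>: a
  relation among the reduced rows lifts to one among the original rows, and row \<open>i\<close>
  receives the coefficient that cancels column \<open>p\<close>. No division occurs, so everything
  stays integral.\<close>

lemma eliminate_pivot:
  fixes a :: "'i \<Rightarrow> 'p \<Rightarrow> int"
  assumes "finite I" "i \<notin> I"
    and "(\<Sum>j\<in>I. k j * (a i p * a j q - a j p * a i q)) = 0"
  shows "(\<Sum>j\<in>insert i I. (if j = i then - (\<Sum>j\<in>I. k j * a j p) else a i p * k j) * a j q) = 0"
proof -
  have "(\<Sum>j\<in>I. (if j = i then - (\<Sum>j\<in>I. k j * a j p) else a i p * k j) * a j q) =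
        (\<Sum>j\<in>I. a i p * k j * a j q)"
    using assms(2) by (intro sum.cong) auto
  moreover have "(\<Sum>j\<in>I. a i p * k j * a j q) - (\<Sum>j\<in>I. k j * a j p) * a i q = 0"
    using assms(3) by (simp add: sum_distrib_left sum_distrib_right sum_subtractf algebra_simps)
  ultimately show ?thesis
    using assms by simp
qed

lemma exists_relation:
  fixes a :: "'i \<Rightarrow> 'p \<Rightarrow> int"
  assumes "finite P" "finite I" "card P < card I"
  shows "\<exists>k. (\<exists>i\<in>I. k i \<noteq> 0) \<and> (\<forall>p\<in>P. (\<Sum>i\<in>I. k i * a i p) = 0)"
  using assms
proof (induction P arbitrary: I a rule: finite_induct)
  case empty
  then have "I \<noteq> {}" by auto
  then show ?case by (intro exI[of _ "\<lambda>_. 1"]) auto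
next
  case (insert p P)
  show ?case
  proof (cases "\<forall>i\<in>I. a i p = 0")
    case True
    then show ?thesis
      using insert.IH[of I a] insert.prems insert.hyps by auto
  next
    case False
    then obtain i where i: "i \<in> I" "a i p \<noteq> 0" by auto
    define J where "J = I - {i}"
    have J: "finite J" "i \<notin> J" "I = insert i J" "card P < card J"
      using i insert.prems insert.hyps by (auto simp: J_def)
    obtain k where k: "\<exists>j\<in>J. k j \<noteq> 0"
      "\<forall>q\<in>P. (\<Sum>j\<in>J. k j * (a i p * a j q - a j p * a i q)) = 0"
      using insert.IH[OF J(1,4), of "\<lambda>j q. a i p * a j q - a j p * a i q"] by blast
    have "(\<Sum>j\<in>J. k j * (a i p * a j q - a j p * a i q)) = 0" if "q \<in> insert p P" for q
      using k(2) that by (auto simp: mult.commute)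
    then have "\<forall>q\<in>insert p P. (\<Sum>j\<in>insert i J.
        (if j = i then - (\<Sum>j\<in>J. k j * a j p) else a i p * k j) * a j q) = 0"
      by (intro ballI eliminate_pivot[OF J(1,2)])
    moreover have "\<exists>j\<in>insert i J. (if j = i then - (\<Sum>j\<in>J. k j * a j p) else a i p * k j) \<noteq> 0"
    proof -
      obtain j where "j \<in> J" "k j \<noteq> 0" using k(1) by blast
      then show ?thesis
        using i(2) J(2) by (intro bexI[of _ j]) auto
    qed
    ultimately show ?thesis
      unfolding J(3) by (intro exI[of _ "\<lambda>j. if j = i then - (\<Sum>j\<in>J. k j * a j p) else a i p * k j"] conjI)
  qed
qed

text \<open>Here the induction runs over the rows, so the bound does not depend on the number of
  columns, which will be the primes dividing some coordinate. In place of a count of columns, a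
  relation \<open>k\<close> of arbitrary size is assumed; it survives each elimination step and
  guarantees that the reduced system is still solvable.\<close>

lemma bounded_relation:
  fixes a :: "'i \<Rightarrow> 'p \<Rightarrow> int" and A N :: int
  assumes "finite I" "int (card I) \<le> N" "2 \<le> N" "1 \<le> A"
    and "\<And>i p. i \<in> I \<Longrightarrow> p \<in> P \<Longrightarrow> \<bar>a i p\<bar> \<le> A"
    and "\<exists>i\<in>I. k i \<noteq> 0" "\<And>p. p \<in> P \<Longrightarrow> (\<Sum>i\<in>I. k i * a i p) = 0"
  shows "\<exists>k. (\<exists>i\<in>I. k i \<noteq> 0) \<and> (\<forall>p\<in>P. (\<Sum>i\<in>I. k i * a i p) = 0) \<and>
             (\<forall>i\<in>I. \<bar>k i\<bar> \<le> (N * A) ^ (2 ^ card I - 1))"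
  using assms
proof (induction I arbitrary: a A k rule: finite_induct)
  case empty
  then show ?case by simp
next
  case (insert i I)
  have NA: "1 \<le> N * A"
    using insert.prems(2,3) mult_mono[of 1 N 1 A] by simp
  show ?case
  proof (cases "\<forall>p\<in>P. a i p = 0")
    \<comment> \<open>A zero row is a relation on its own, with coefficient 1.\<close>
    case True
    have "(\<Sum>j\<in>insert i I. of_bool (j = i) * a j p) = 0" if "p \<in> P" for p
      using True that insert.hyps by (auto intro!: sum.neutral)
    then show ?thesis
      using NA by (intro exI[of _ "\<lambda>j. of_bool (j = i)"]) (auto simp: one_le_power)
  next
    case False
    then obtain p where p: "p \<in> P" "a i p \<noteq> 0" by auto
    define b where "b = (\<lambda>j q. a i p * a j q - a j p * a i q)"
    have bA: "\<bar>b j q\<bar> \<le> 2 * A\<^sup>2" if "j \<in> I" "q \<in> P" for j q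
    proof -
      have "\<bar>a i p * a j q\<bar> \<le> A * A" "\<bar>a j p * a i q\<bar> \<le> A * A"
        unfolding abs_mult using insert.prems(3,4) that p(1) by (intro mult_mono; auto)+
      then show ?thesis
        unfolding b_def power2_eq_square by linarith
    qed
    have k_i: "k i * a i q = - (\<Sum>j\<in>I. k j * a j q)" if "q \<in> P" for q
      using insert.prems(6)[OF that] insert.hyps by simp
    have rel: "(\<Sum>j\<in>I. k j * b j q) = 0" if "q \<in> P" for q
    proof -
      have "(\<Sum>j\<in>I. k j * b j q) = a i p * (\<Sum>j\<in>I. k j * a j q) - (\<Sum>j\<in>I. k j * a j p) * a i q"
        by (simp add: b_def sum_distrib_left sum_distrib_right sum_subtractf algebra_simps)
      also have "\<dots> = 0"
      proof -
        have *: "(\<Sum>j\<in>I. k j * a j r) = - (k i * a i r)" if "r \<in> P" for r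
          using k_i[OF that] by linarith
        show ?thesis
          unfolding *[OF that] *[OF p(1)] by simp
      qed
      finally show ?thesis .
    qed
    \<comment> \<open>If \<open>k\<close> vanished on \<open>I\<close>, the relation in column
      \<open>p\<close> would read \<open>k i * a i p = 0\<close>, and the pivot is non-zero.\<close>
    have nz: "\<exists>j\<in>I. k j \<noteq> 0"
    proof (rule ccontr)
      assume *: "\<not> ?thesis"
      then have "k i * a i p = 0"
        using k_i[OF p(1)] by simp
      then show False
        using p(2) * insert.prems(5) by auto
    qed
    have A2: "1 \<le> 2 * A\<^sup>2"
      using insert.prems(3) one_le_power[of A 2] by linarith
    have cI: "int (card I) \<le> N"
      using insert.prems(1) insert.hyps by simp
    have "\<exists>k. (\<exists>j\<in>I. k j \<noteq> 0) \<and> (\<forall>q\<in>P. (\<Sum>j\<in>I. k j * b j q) = 0) \<and>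
        (\<forall>j\<in>I. \<bar>k j\<bar> \<le> (N * (2 * A\<^sup>2)) ^ (2 ^ card I - 1))"
      by (rule insert.IH[of "2 * A\<^sup>2" b k]) (use cI insert.prems(2) A2 bA nz rel in auto)
    then obtain k' where k': "\<exists>j\<in>I. k' j \<noteq> 0" "\<forall>q\<in>P. (\<Sum>j\<in>I. k' j * b j q) = 0"
      "\<forall>j\<in>I. \<bar>k' j\<bar> \<le> (N * (2 * A\<^sup>2)) ^ (2 ^ card I - 1)" by blast
    define E :: nat where "E = 2 ^ card I - 1"
    \<comment> \<open>The exponent doubles because reduced entries are quadratic in the old ones;
      the extra factor \<open>N * A\<close> pays for lifting the relation back.\<close>
    have E: "2 ^ card (insert i I) - 1 = Suc (2 * E)"
    proof -
      have "(1::nat) \<le> 2 ^ card I" by simp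
      then show ?thesis
        unfolding E_def card_insert_disjoint[OF insert.hyps] power_Suc by linarith
    qed
    \<comment> \<open>The factor 2 in the bound for the reduced entries is absorbed by a second
      factor \<open>N\<close>.\<close>
    have "(N * (2 * A\<^sup>2)) ^ E \<le> ((N * A) ^ 2) ^ E"
    proof (rule power_mono)
      have "N * (2 * A\<^sup>2) \<le> N * (N * A\<^sup>2)"
        using insert.prems(2) by (intro mult_left_mono mult_right_mono) auto
      then show "N * (2 * A\<^sup>2) \<le> (N * A) ^ 2"
        by (simp add: power2_eq_square algebra_simps)
    qed (use insert.prems(2) in auto)
    then have k'_le: "\<bar>k' j\<bar> \<le> (N * A) ^ (2 * E)" if "j \<in> I" for j
      using k'(3) that by (fastforce simp: E_def power_mult)
    have pos: "0 \<le> (N * A) ^ (2 * E)"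
      using NA by simp
    define c where "c = (\<lambda>j. if j = i then - (\<Sum>j\<in>I. k' j * a j p) else a i p * k' j)"
    have "\<bar>c j\<bar> \<le> (N * A) ^ Suc (2 * E)" if "j \<in> insert i I" for j
    proof (cases "j = i")
      case True
      have "\<bar>\<Sum>j\<in>I. k' j * a j p\<bar> \<le> (\<Sum>j\<in>I. (N * A) ^ (2 * E) * A)"
        using k'_le insert.prems(4) p(1) pos
        by (intro order.trans[OF sum_abs] sum_mono) (auto simp: abs_mult intro!: mult_mono)
      also have "\<dots> = int (card I) * ((N * A) ^ (2 * E) * A)"
        by simp
      also have "\<dots> \<le> N * ((N * A) ^ (2 * E) * A)"
        using cI pos insert.prems(3) by (intro mult_right_mono) auto
      finally show ?thesis
        using True by (simp add: c_def algebra_simps)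
    next
      case False
      then have "j \<in> I"
        using that by simp
      have "\<bar>a i p * k' j\<bar> \<le> (N * A) * (N * A) ^ (2 * E)"
        unfolding abs_mult
      proof (rule mult_mono)
        have "A \<le> N * A"
          using insert.prems(2,3) mult_right_mono[of 1 N A] by simp
        then show "\<bar>a i p\<bar> \<le> N * A"
          using insert.prems(4)[of i p] p(1) by simp
      qed (use k'_le \<open>j \<in> I\<close> NA in auto)
      then show ?thesis
        using False by (simp add: c_def)
    qed
    moreover have "(\<Sum>j\<in>insert i I. c j * a j q) = 0" if "q \<in> P" for q
      unfolding c_def using eliminate_pivot[of I i k' a p q] k'(2) that insert.hyps by (simp add: b_def)
    moreover have "\<exists>j\<in>insert i I. c j \<noteq> 0"
      using k'(1) p(2) insert.hyps by (auto simp: c_def)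
    ultimately show ?thesis
      unfolding E by blast
  qed
qed

section \<open>Expansions in base \<open>W\<close> with signed digits\<close>

lemma abs_digit_sum_less:
  fixes k :: "nat \<Rightarrow> int"
  assumes "\<And>i. i < n \<Longrightarrow> \<bar>k i\<bar> < W"
  shows "\<bar>\<Sum>i<n. k i * W ^ i\<bar> < W ^ n"
  using assms
proof (induction n)
  case (Suc n)
  then have IH: "\<bar>\<Sum>i<n. k i * W ^ i\<bar> < W ^ n" by simp
  have "\<bar>k n\<bar> * W ^ n \<le> (W - 1) * W ^ n"
    using Suc.prems[of n] IH by (intro mult_right_mono) auto
  then have "\<bar>k n * W ^ n\<bar> \<le> W * W ^ n - W ^ n"
    using IH by (simp add: abs_mult left_diff_distrib)
  with IH show ?case by simp
qed simp

text \<open>A non-zero top digit would contribute at least \<open>W ^ n\<close> in absolute value,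
  more than the lower digits can cancel.\<close>

lemma digit_sum_eq_0D:
  fixes k :: "nat \<Rightarrow> int"
  assumes "\<And>i. i < n \<Longrightarrow> \<bar>k i\<bar> < W" "(\<Sum>i<n. k i * W ^ i) = 0" "i < n"
  shows "k i = 0"
  using assms
proof (induction n)
  case (Suc n)
  have *: "\<bar>\<Sum>i<n. k i * W ^ i\<bar> < W ^ n"
    by (rule abs_digit_sum_less) (use Suc.prems(1) in auto)
  have "k n = 0"
  proof (rule ccontr)
    assume "k n \<noteq> 0"
    then have "W ^ n \<le> \<bar>k n\<bar> * W ^ n"
      using * mult_right_mono[of 1 "\<bar>k n\<bar>" "W ^ n"] by auto
    also have "\<dots> = \<bar>k n * W ^ n\<bar>"
      using * by (simp add: abs_mult)
    finally show False
      using * Suc.prems(2) by simp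
  qed
  then show ?case
    using Suc less_Suc_eq by auto
qed simp

section \<open>Multiplicatively dependent vectors\<close>

lemma powi_eq_exp:
  assumes "(x::real) > 0"
  shows "x powi k = exp (of_int k * ln x)"
  using powr_real_of_int'[of x k] assms by (simp add: powr_def)

text \<open>Logarithms of absolute values make the condition linear. The signs of the coordinates
  are immaterial, because a relation between absolute values can be squared.\<close>

lemma mult_dep_iff:
  "v \<in> mult_dep n \<longleftrightarrow> v \<in> {..<n} \<rightarrow>\<^sub>E UNIV \<and> (\<forall>i<n. v i \<noteq> 0) \<and>
     (\<exists>k :: nat \<Rightarrow> int. (\<exists>i<n. k i \<noteq> 0) \<and> (\<Sum>i<n. of_int (k i) * ln \<bar>real_of_int (v i)\<bar>) = 0)"
  (is "_ \<longleftrightarrow> ?A \<and> ?B \<and> ?C")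
proof
  assume "v \<in> mult_dep n"
  then obtain k where k: "?A" "?B" "\<exists>i<n. k i \<noteq> 0" "(\<Prod>i<n. real_of_int (v i) powi k i) = 1"
    unfolding mult_dep_def by auto
  have "(\<Prod>i<n. \<bar>real_of_int (v i)\<bar> powi k i) = \<bar>\<Prod>i<n. real_of_int (v i) powi k i\<bar>"
    unfolding abs_prod power_int_abs ..
  also have "\<dots> = 1" using k(4) by simp
  also have "(\<Prod>i<n. \<bar>real_of_int (v i)\<bar> powi k i) =
      (\<Prod>i<n. exp (of_int (k i) * ln \<bar>real_of_int (v i)\<bar>))"
    using k(2) by (intro prod.cong) (auto simp: powi_eq_exp)
  finally have "exp (\<Sum>i<n. of_int (k i) * ln \<bar>real_of_int (v i)\<bar>) = 1"
    by (simp add: exp_sum)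
  then show "?A \<and> ?B \<and> ?C" using k by auto
next
  assume "?A \<and> ?B \<and> ?C"
  then obtain k :: "nat \<Rightarrow> int" where k: "?A" "?B" "\<exists>i<n. k i \<noteq> 0"
    "(\<Sum>i<n. of_int (k i) * ln \<bar>real_of_int (v i)\<bar>) = 0" by auto
  \<comment> \<open>doubling the exponents removes the signs\<close>
  define k2 where "k2 = restrict (\<lambda>i. 2 * k i) {..<n}"
  have "real_of_int (v i) powi k2 i = exp (of_int (k i) * ln \<bar>real_of_int (v i)\<bar>) ^ 2" if "i < n" for i
  proof -
    have "real_of_int (v i) powi k2 i = (real_of_int (v i) powi 2) powi k i"
      using that by (simp only: k2_def restrict_apply lessThan_iff if_True power_int_mult)
    also have "real_of_int (v i) powi 2 = \<bar>real_of_int (v i)\<bar> powi 2"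
      by simp
    also have "\<dots> powi k i = (\<bar>real_of_int (v i)\<bar> powi k i) powi 2"
      by (simp only: power_int_mult [symmetric] mult.commute)
    also have "\<dots> = exp (of_int (k i) * ln \<bar>real_of_int (v i)\<bar>) ^ 2"
      using k(2) that by (simp add: powi_eq_exp)
    finally show ?thesis .
  qed
  then have "(\<Prod>i<n. real_of_int (v i) powi k2 i) =
      (\<Prod>i<n. exp (of_int (k i) * ln \<bar>real_of_int (v i)\<bar>)) ^ 2"
    by (simp add: prod_power_distrib)
  also have "\<dots> = 1"
    using k(4) by (simp flip: exp_sum)
  finally show "v \<in> mult_dep n"
    unfolding mult_dep_def using k by (auto intro!: bexI[of _ k2] simp: k2_def)
qed

lemma ones_mult_dep: "0 < n \<Longrightarrow> restrict (\<lambda>_. 1) {..<n} \<in> mult_dep n"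
  by (subst mult_dep_iff) (auto intro!: exI[of _ "\<lambda>_. 1"])

text \<open>The set \<open>P\<close> may exceed the prime factors of \<open>w\<close>, so that one
  set of primes serves all coordinates of a vector.\<close>

lemma ln_eq_sum_multiplicity:
  assumes "finite P" "prime_factors w \<subseteq> P" "\<forall>p\<in>P. prime p" "(w::nat) > 0"
  shows "ln (real w) = (\<Sum>p\<in>P. real (multiplicity p w) * ln (real p))"
proof -
  have "real w = real (\<Prod>p\<in>prime_factors w. p ^ multiplicity p w)"
    by (rule arg_cong[OF prime_factorization_nat[OF assms(4)]])
  also have "\<dots> = (\<Prod>p\<in>prime_factors w. real p ^ multiplicity p w)" (is "_ = ?r")
    by simp
  finally have "ln (real w) = ln ?r"
    by (rule arg_cong)
  also have "\<dots> = (\<Sum>p\<in>prime_factors w. ln (real p ^ multiplicity p w))"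
    by (rule ln_prod) (auto simp: in_prime_factors_iff)
  also have "\<dots> = (\<Sum>p\<in>prime_factors w. real (multiplicity p w) * ln (real p))"
    by (intro sum.cong refl ln_realpow)
  also have "\<dots> = (\<Sum>p\<in>P. real (multiplicity p w) * ln (real p))"
    using assms by (intro sum.mono_neutral_left)
      (auto simp: in_prime_factors_iff not_dvd_imp_multiplicity_0)
  finally show ?thesis .
qed

section \<open>The covering radius\<close>

text \<open>Non-negativity of \<open>H\<close> makes the ball non-empty, so that the supremum is at
  most any upper bound.\<close>

lemma rho_leI:
  assumes "0 \<le> H"
    and "\<And>x. x \<in> {..<n} \<rightarrow>\<^sub>E UNIV \<Longrightarrow> L2_set x {..<n} \<le> H \<Longrightarrow>
      \<exists>v\<in>mult_dep n. L2_set (\<lambda>i. x i - real_of_int (v i)) {..<n} \<le> d"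
  shows "rho n H \<le> d"
  unfolding rho_def
proof (rule cSUP_least)
  show "{x \<in> {..<n} \<rightarrow>\<^sub>E UNIV. L2_set x {..<n} \<le> H} \<noteq> {}"
  proof -
    have "restrict (\<lambda>_. 0) {..<n} \<in> {x \<in> {..<n} \<rightarrow>\<^sub>E (UNIV :: real set). L2_set x {..<n} \<le> H}"
      using assms(1) by (simp add: L2_set_def)
    then show ?thesis by blast
  qed
next
  fix x assume "x \<in> {x \<in> {..<n} \<rightarrow>\<^sub>E (UNIV :: real set). L2_set x {..<n} \<le> H}"
  then obtain v where "v \<in> mult_dep n" "L2_set (\<lambda>i. x i - real_of_int (v i)) {..<n} \<le> d"
    using assms(2)[of x] by auto
  moreover have "bdd_below ((\<lambda>v. L2_set (\<lambda>i. x i - real_of_int (v i)) {..<n}) ` mult_dep n)"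
    by (rule bdd_belowI2[of _ 0]) simp
  ultimately show "(INF v\<in>mult_dep n. L2_set (\<lambda>i. x i - real_of_int (v i)) {..<n}) \<le> d"
    by (meson cINF_lower order_trans)
qed

lemma dist_ones_le:
  assumes "L2_set x {..<n} \<le> H"
  shows "L2_set (\<lambda>i. x i - real_of_int (restrict (\<lambda>_. 1) {..<n} i)) {..<n} \<le> H + real n"
proof -
  have "L2_set (\<lambda>i. x i - real_of_int (restrict (\<lambda>_. 1) {..<n} i)) {..<n} =
      L2_set (\<lambda>i. x i + (- 1)) {..<n}"
    by (intro L2_set_cong) auto
  also have "\<dots> \<le> L2_set x {..<n} + L2_set (\<lambda>_. - 1) {..<n}"
    by (rule L2_set_triangle_ineq)
  also have "L2_set (\<lambda>_. - 1) {..<n} \<le> real n"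
    by (rule order_trans[OF L2_set_le_sum_abs]) simp
  finally show ?thesis using assms by simp
qed

lemma rho_le_trivial:
  assumes "0 < n" "0 \<le> H"
  shows "rho n H \<le> H + real n"
  using assms dist_ones_le ones_mult_dep by (blast intro: rho_leI)

text \<open>A single point bounds the supremum from below once the distances are known to be bounded
  above on the ball; the all-ones vector provides the bound \<open>H + real n\<close>.\<close>

lemma rho_geI:
  assumes "0 < n" "x \<in> {..<n} \<rightarrow>\<^sub>E UNIV" "L2_set x {..<n} \<le> H"
    and "\<And>v. v \<in> mult_dep n \<Longrightarrow> d \<le> L2_set (\<lambda>i. x i - real_of_int (v i)) {..<n}"
  shows "d \<le> rho n H"
proof -
  define X where "X = {x \<in> {..<n} \<rightarrow>\<^sub>E (UNIV :: real set). L2_set x {..<n} \<le> H}"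
  define F where "F = (\<lambda>x. INF v\<in>mult_dep n. L2_set (\<lambda>i. x i - real_of_int (v i)) {..<n})"
  have ne: "mult_dep n \<noteq> {}"
    using ones_mult_dep[OF assms(1)] by blast
  have "bdd_above (F ` X)"
  proof (rule bdd_aboveI2)
    fix y assume "y \<in> X"
    have "F y \<le> L2_set (\<lambda>i. y i - real_of_int (restrict (\<lambda>_. 1) {..<n} i)) {..<n}"
      unfolding F_def
      by (rule cINF_lower[OF _ ones_mult_dep[OF assms(1)]]) (rule bdd_belowI2[of _ 0], simp)
    also have "\<dots> \<le> H + real n"
      by (rule dist_ones_le) (use \<open>y \<in> X\<close> in \<open>simp add: X_def\<close>)
    finally show "F y \<le> H + real n" .
  qed
  moreover have "x \<in> X" using assms by (simp add: X_def)
  ultimately have "F x \<le> (SUP x\<in>X. F x)" by (rule cSUP_upper2) simp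
  moreover have "d \<le> F x"
    unfolding F_def by (rule cINF_greatest[OF ne]) (rule assms(4))
  ultimately show ?thesis
    unfolding rho_def X_def F_def by linarith
qed

text \<open>The origin has distance at least 1 from every vector with non-zero integer coordinates.
  This takes care of bounded ranges of \<open>H\<close> in the lower estimates.\<close>

lemma one_le_rho:
  assumes "0 < n" "0 \<le> H"
  shows "1 \<le> rho n H"
proof (rule rho_geI[of n "restrict (\<lambda>_. 0) {..<n}"])
  show "L2_set (restrict (\<lambda>_. 0) {..<n}) {..<n} \<le> H"
    using assms by (simp add: L2_set_def)
next
  fix v assume "v \<in> mult_dep n"
  then have "v 0 \<noteq> 0" using assms(1) by (simp add: mult_dep_iff)
  then have "1 \<le> \<bar>restrict (\<lambda>_. 0) {..<n} 0 - real_of_int (v 0)\<bar>"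
    using assms(1) by auto
  also have "\<dots> \<le> L2_set (\<lambda>i. \<bar>restrict (\<lambda>_. 0) {..<n} i - real_of_int (v i)\<bar>) {..<n}"
    using assms(1) by (intro member_le_L2_set[of _ 0]) auto
  finally show "1 \<le> L2_set (\<lambda>i. restrict (\<lambda>_. 0) {..<n} i - real_of_int (v i)) {..<n}"
    by (simp add: L2_set_def)
qed (use assms in auto)

lemma abs_le_L2_set:
  assumes "finite A" "i \<in> A"
  shows "\<bar>f i\<bar> \<le> L2_set f A"
  using member_le_L2_set[OF assms, of "\<lambda>i. \<bar>f i\<bar>"] by (simp add: L2_set_def)

section \<open>Dimension two\<close>

text \<open>The relation says that a power of \<open>a\<close> equals a power of \<open>b\<close>.
  As \<open>a \<le> b\<close>, the exponent of \<open>a\<close> is the larger one, so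
  \<open>a ^ nat \<bar>l\<bar>\<close> divides \<open>b ^ nat \<bar>l\<bar>\<close>, and
  divisibility passes to the bases.\<close>

lemma dvd_of_ln_rel:
  fixes a b :: nat
  assumes "1 < a" "1 < b" "a \<le> b" "k \<noteq> 0" "of_int k * ln (real a) + of_int l * ln (real b) = 0"
  shows "a dvd b"
proof -
  have la: "0 < ln (real a)" "0 < ln (real b)" "ln (real a) \<le> ln (real b)"
    using assms by auto
  have "\<bar>of_int k\<bar> * ln (real a) = \<bar>of_int l\<bar> * ln (real b)"
    using assms(5) la by (metis abs_minus_cancel abs_mult abs_of_pos add_eq_0_iff)
  then have eq: "real (nat \<bar>k\<bar>) * ln (real a) = real (nat \<bar>l\<bar>) * ln (real b)"
    by simp
  then have "ln (real (a ^ nat \<bar>k\<bar>)) = ln (real (b ^ nat \<bar>l\<bar>))"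
    using assms by (simp add: ln_realpow)
  then have pow: "a ^ nat \<bar>k\<bar> = b ^ nat \<bar>l\<bar>"
    using assms by (subst (asm) ln_inj_iff) (auto simp del: of_nat_power)
  have "nat \<bar>l\<bar> \<le> nat \<bar>k\<bar>"
  proof (rule ccontr)
    assume "\<not> ?thesis"
    then have "real (nat \<bar>k\<bar>) * ln (real a) < real (nat \<bar>l\<bar>) * ln (real a)"
      using la by (intro mult_strict_right_mono) auto
    also have "\<dots> \<le> real (nat \<bar>l\<bar>) * ln (real b)"
      using la by (intro mult_left_mono) auto
    finally show False using eq by simp
  qed
  moreover have "nat \<bar>l\<bar> \<noteq> 0"
    using eq la assms(4) by auto
  ultimately have "a ^ nat \<bar>l\<bar> dvd b ^ nat \<bar>l\<bar>"
    unfolding pow[symmetric] by (intro le_imp_power_dvd)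
  then show ?thesis
    using \<open>nat \<bar>l\<bar> \<noteq> 0\<close> by (simp add: pow_divides_pow_iff)
qed

lemma mult_dep_2_cases:
  assumes "v \<in> mult_dep 2"
  obtains "\<bar>v 0\<bar> = 1" | "\<bar>v 1\<bar> = 1" | "\<bar>v 0\<bar> = \<bar>v 1\<bar>" | "2 * \<bar>v 0\<bar> \<le> \<bar>v 1\<bar>" | "2 * \<bar>v 1\<bar> \<le> \<bar>v 0\<bar>"
proof -
  \<comment> \<open>By symmetry the smaller absolute value may come first; it divides the larger
    one, and a quotient other than 1 is at least 2.\<close>
  have step: "a = 1 \<or> b = 1 \<or> a = b \<or> 2 * a \<le> b"
    if "0 < a" "0 < b" "a \<le> b" "k \<noteq> 0 \<or> l \<noteq> 0" "of_int k * ln (real a) + of_int l * ln (real b) = 0"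
    for a b :: nat and k l :: int
  proof (cases "a = 1 \<or> b = 1")
    case False
    then have ab: "1 < a" "1 < b" using that by auto
    then have "k \<noteq> 0" using that by auto
    then have "a dvd b" by (rule dvd_of_ln_rel[OF ab that(3) _ that(5)])
    then obtain c where c: "b = a * c" by (rule dvdE)
    then have "c \<noteq> 0" using that(2) by auto
    then have "c = 1 \<or> 2 \<le> c" by auto
    then show ?thesis using c by auto
  qed auto
  have two: "{..<2::nat} = {0, 1}" by auto
  from assms obtain k :: "nat \<Rightarrow> int" where nz: "v 0 \<noteq> 0" "v 1 \<noteq> 0" and k: "k 0 \<noteq> 0 \<or> k 1 \<noteq> 0"
    "of_int (k 0) * ln \<bar>real_of_int (v 0)\<bar> + of_int (k 1) * ln \<bar>real_of_int (v 1)\<bar> = 0"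
    unfolding mult_dep_iff two by (auto simp: less_2_cases_iff)
  define a b where "a = nat \<bar>v 0\<bar>" and "b = nat \<bar>v 1\<bar>"
  have ab: "\<bar>v 0\<bar> = int a" "\<bar>v 1\<bar> = int b" "0 < a" "0 < b"
    using nz by (auto simp: a_def b_def)
  have k2: "of_int (k 0) * ln (real a) + of_int (k 1) * ln (real b) = 0"
    using k(2) by (simp add: a_def b_def)
  have "a = 1 \<or> b = 1 \<or> a = b \<or> 2 * a \<le> b \<or> 2 * b \<le> a"
  proof (cases "a \<le> b")
    case True
    then show ?thesis using step[of a b "k 0" "k 1"] ab k(1) k2 by auto
  next
    case False
    then show ?thesis using step[of b a "k 1" "k 0"] ab k(1) k2 by (auto simp: add.commute)
  qed
  then show ?thesis
    using that ab by auto
qed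

lemma rho_2_ge:
  assumes "8 \<le> H"
  shows "H / 32 \<le> rho 2 H"
proof (rule rho_geI)
  \<comment> \<open>Since the square root of 13 is below 4, the point lies in the ball.
    \<open>8 \<le> H\<close> gives \<open>2 \<le> t\<close>, which keeps coordinates within
    \<open>t / 8\<close> of the point away from 1; the ratio 3/2 stays clear of 1 and of 2.\<close>
  define t where "t = H / 4"
  have t: "2 \<le> t" using assms by (simp add: t_def)
  define x where "x = restrict (\<lambda>i. if i = 0 then 2 * t else 3 * t) {..<2::nat}"
  have x: "x 0 = 2 * t" "x 1 = 3 * t" by (auto simp: x_def)
  have two: "{..<2::nat} = {0, 1}" by auto
  show "x \<in> {..<2} \<rightarrow>\<^sub>E UNIV" by (simp add: x_def)
  have "L2_set x {..<2} = sqrt (13 * t\<^sup>2)"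
    unfolding L2_set_def two by (simp add: x[unfolded One_nat_def] power2_eq_square)
  also have "\<dots> \<le> sqrt ((4 * t)\<^sup>2)"
    by (intro real_sqrt_le_mono) (simp add: power2_eq_square)
  finally show "L2_set x {..<2} \<le> H"
    using t by (simp add: t_def)
  fix v assume v: "v \<in> mult_dep 2"
  define d where "d = L2_set (\<lambda>i. x i - real_of_int (v i)) {..<2}"
  have d: "\<bar>2 * t - real_of_int (v 0)\<bar> \<le> d" "\<bar>3 * t - real_of_int (v 1)\<bar> \<le> d"
    unfolding d_def using abs_le_L2_set[of "{..<2}" _ "\<lambda>i. x i - real_of_int (v i)"] x
    by (metis finite_lessThan lessThan_iff pos2, metis finite_lessThan lessThan_iff one_less_numeral_iff semiring_norm(76))
  have "t / 8 \<le> d"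
  proof (rule ccontr)
    assume "\<not> ?thesis"
    then have *: "\<bar>2 * t - real_of_int (v 0)\<bar> < t / 8" "\<bar>3 * t - real_of_int (v 1)\<bar> < t / 8"
      using d by linarith+
    then have "0 < v 0" "0 < v 1"
      using t by linarith+
    with v consider "v 0 = 1" | "v 1 = 1" | "v 0 = v 1" | "2 * v 0 \<le> v 1" | "2 * v 1 \<le> v 0"
      by (cases rule: mult_dep_2_cases) auto
    then show False
    proof cases
      case 3
      then have "real_of_int (v 0) = real_of_int (v 1)" by simp
      then show ?thesis using * t by linarith
    next
      case 4
      then have "2 * real_of_int (v 0) \<le> real_of_int (v 1)"
        by (metis of_int_le_iff of_int_mult of_int_numeral)
      then show ?thesis using * t by linarith
    next
      case 5
      then have "2 * real_of_int (v 1) \<le> real_of_int (v 0)"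
        by (metis of_int_le_iff of_int_mult of_int_numeral)
      then show ?thesis using * t by linarith
    qed (use * t in auto)
  qed
  then show "H / 32 \<le> L2_set (\<lambda>i. x i - real_of_int (v i)) {..<2}"
    by (simp add: d_def t_def)
qed simp

section \<open>Computability of the exponent\<close>

lemma mu_recursive_comp1:
  assumes "mu_recursive 1 f" "mu_recursive n g"
  shows "mu_recursive n (\<lambda>xs. f [g xs])"
proof -
  have "mu_recursive n (\<lambda>xs. f (map (\<lambda>g. g xs) [g]))"
    by (rule mu_recursive.comp) (use assms in simp_all)
  then show ?thesis by (simp only: list.map)
qed

lemma mu_recursive_Suc:
  assumes "mu_recursive n g"
  shows "mu_recursive n (\<lambda>xs. Suc (g xs))"
  using mu_recursive_comp1[OF mu_recursive.succ assms] by simp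

lemma mu_recursive_dbl: "\<exists>f. mu_recursive 1 f \<and> (\<forall>y. f [y] = 2 * y)"
proof -
  \<comment> \<open>In primitive recursion the step function receives the counter first, so
    \<open>xs ! 1\<close> is the value accumulated so far.\<close>
  have "mu_recursive (0 + 2) (\<lambda>xs. Suc (Suc (xs ! 1)))"
    by (intro mu_recursive_Suc mu_recursive.proj) simp
  from mu_recursive.prim_rec[OF mu_recursive.zero this]
  have "mu_recursive 1 (\<lambda>xs. rec_nat 0 (\<lambda>m y. Suc (Suc y)) (hd xs))"
    by simp
  moreover have "rec_nat 0 (\<lambda>m y. Suc (Suc y)) n = 2 * n" for n :: nat
    by (induction n) auto
  ultimately show ?thesis
    by (intro exI[of _ "\<lambda>xs. rec_nat 0 (\<lambda>m y. Suc (Suc y)) (hd xs)"]) simp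
qed

lemma mu_recursive_pow2: "\<exists>f. mu_recursive 1 f \<and> (\<forall>k. f [k] = 2 ^ k)"
proof -
  obtain d where d: "mu_recursive 1 d" "\<And>y. d [y] = 2 * y"
    using mu_recursive_dbl by blast
  have "mu_recursive (0 + 2) (\<lambda>xs. d [xs ! 1])"
    by (intro mu_recursive_comp1[OF d(1)] mu_recursive.proj) simp
  from mu_recursive.prim_rec[OF mu_recursive_Suc[OF mu_recursive.zero] this]
  have "mu_recursive 1 (\<lambda>xs. rec_nat 1 (\<lambda>m y. 2 * y) (hd xs))"
    by (simp add: d(2))
  moreover have "rec_nat 1 (\<lambda>m y. 2 * y) k = (2 ^ k :: nat)" for k :: nat
    by (induction k) auto
  ultimately show ?thesis
    by (intro exI[of _ "\<lambda>xs. rec_nat 1 (\<lambda>m y. 2 * y) (hd xs)"]) simp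
qed

text \<open>The exponent is an integer, so the numerator \<open>4 ^ n * 2 ^ k\<close> is exact and
  \<open>q\<close> can be zero. The recursion runs over the first argument \<open>n\<close> and
  starts from \<open>2 ^ k\<close>.\<close>

lemma effectively_computable_pow4: "effectively_computable (\<lambda>n. 4 ^ n)"
proof -
  obtain d where d: "mu_recursive 1 d" "\<And>y. d [y] = 2 * y"
    using mu_recursive_dbl by blast
  obtain e where e: "mu_recursive 1 e" "\<And>k. e [k] = 2 ^ k"
    using mu_recursive_pow2 by blast
  have "mu_recursive (1 + 2) (\<lambda>xs. d [d [xs ! 1]])"
    by (intro mu_recursive_comp1[OF d(1)] mu_recursive.proj) simp
  from mu_recursive.prim_rec[OF e(1) this]
  have p: "mu_recursive 2 (\<lambda>xs. rec_nat (e (tl xs)) (\<lambda>m y. 2 * (2 * y)) (hd xs))"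
    by (simp add: d(2) numeral_2_eq_2)
  have "rec_nat (2 ^ k) (\<lambda>m y. 2 * (2 * y)) n = (4 ^ n * 2 ^ k :: nat)" for n k :: nat
    by (induction n) auto
  then show ?thesis
    unfolding effectively_computable_def
    using p mu_recursive.zero[of 2]
    by (intro exI[of _ "\<lambda>xs. rec_nat (e (tl xs)) (\<lambda>m y. 2 * (2 * y)) (hd xs)"] exI[of _ "\<lambda>xs. 0"])
       (simp add: e(2))
qed

section \<open>Lower bound\<close>

lemma multiplicity_prod_power:
  assumes "prime (p::nat)" "finite I" "\<And>i. i \<in> I \<Longrightarrow> w i \<noteq> 0"
  shows "multiplicity p (\<Prod>i\<in>I. w i ^ e i) = (\<Sum>i\<in>I. e i * multiplicity p (w i))"
proof -
  have "multiplicity p (\<Prod>i\<in>I. w i ^ e i) = (\<Sum>i\<in>I. multiplicity p (w i ^ e i))"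
    using assms by (intro prime_elem_multiplicity_prod_distrib) (auto simp: image_iff)
  also have "\<dots> = (\<Sum>i\<in>I. e i * multiplicity p (w i))"
    using assms by (intro sum.cong prime_elem_multiplicity_power_distrib) auto
  finally show ?thesis .
qed

text \<open>Moving negative exponents to the other side gives two equal natural numbers
  \<open>U\<close> and \<open>V\<close>; unique factorisation then compares their exponents at
  \<open>p\<close>.\<close>

lemma multiplicity_rel:
  fixes k :: "nat \<Rightarrow> int" and w :: "nat \<Rightarrow> nat"
  assumes "\<And>i. i < n \<Longrightarrow> 0 < w i" "(\<Sum>i<n. of_int (k i) * ln (real (w i))) = 0" "prime p"
  shows "(\<Sum>i<n. k i * int (multiplicity p (w i))) = 0"
proof -
  have k: "int (nat (k i)) - int (nat (- k i)) = k i" for i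
    by simp
  define U V where "U = (\<Prod>i<n. w i ^ nat (k i))" and "V = (\<Prod>i<n. w i ^ nat (- k i))"
  have pos: "0 < U" "0 < V"
    using assms(1) by (auto simp: U_def V_def)
  have ln_prod_pow: "ln (real (\<Prod>i<n. w i ^ e i)) = (\<Sum>i<n. real (e i) * ln (real (w i)))" for e
  proof -
    have "ln (real (\<Prod>i<n. w i ^ e i)) = ln (\<Prod>i<n. real (w i) ^ e i)"
      by simp
    also have "\<dots> = (\<Sum>i<n. ln (real (w i) ^ e i))"
      by (rule ln_prod) (use assms(1) in auto)
    finally show ?thesis
      by (simp add: ln_realpow)
  qed
  have "ln (real U) - ln (real V) =
      (\<Sum>i<n. (real (nat (k i)) - real (nat (- k i))) * ln (real (w i)))"
    unfolding U_def V_def ln_prod_pow by (simp add: sum_subtractf left_diff_distrib)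
  also have "\<dots> = (\<Sum>i<n. of_int (k i) * ln (real (w i)))"
    by (intro sum.cong refl arg_cong2[where f = times]) linarith
  finally have "U = V"
    using assms(2) pos by simp
  then have "(\<Sum>i<n. nat (k i) * multiplicity p (w i)) = (\<Sum>i<n. nat (- k i) * multiplicity p (w i))"
    using assms(1) multiplicity_prod_power[OF assms(3) finite_lessThan, of n w]
    unfolding U_def V_def by (metis lessThan_iff less_numeral_extra(3))
  then have "(\<Sum>i<n. int (nat (k i)) * int (multiplicity p (w i))) -
      (\<Sum>i<n. int (nat (- k i)) * int (multiplicity p (w i))) = 0"
    by (simp only: of_nat_mult[symmetric] of_nat_sum[symmetric])
  then show ?thesis
    by (simp only: sum_subtractf[symmetric] left_diff_distrib[symmetric] k)
qed

text \<open>The rows are the coordinates, the columns the primes dividing them. A number of size at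
  most \<open>2 ^ A\<close> has prime exponents at most \<open>A\<close>, and the given dependence
  is the relation that \<open>bounded_relation\<close> starts from.\<close>

lemma mult_dep_bounded_relation:
  assumes "v \<in> mult_dep n" "2 \<le> n" "1 \<le> A" "\<And>i. i < n \<Longrightarrow> \<bar>v i\<bar> \<le> 2 ^ A"
  shows "\<exists>k :: nat \<Rightarrow> int. (\<exists>i<n. k i \<noteq> 0) \<and> (\<Sum>i<n. of_int (k i) * ln \<bar>real_of_int (v i)\<bar>) = 0 \<and>
      (\<forall>i<n. \<bar>k i\<bar> \<le> (int n * int A) ^ (2 ^ n - 1))"
proof -
  define w where "w = (\<lambda>i. nat \<bar>v i\<bar>)"
  have w: "\<bar>real_of_int (v i)\<bar> = real (w i)" for i
    by (simp add: w_def)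
  from assms(1) obtain k :: "nat \<Rightarrow> int" where k: "\<exists>i<n. k i \<noteq> 0"
    "(\<Sum>i<n. of_int (k i) * ln (real (w i))) = 0" and wpos: "\<And>i. i < n \<Longrightarrow> 0 < w i"
    unfolding mult_dep_iff w by (auto simp: w_def)
  define P where "P = (\<Union>i<n. prime_factors (w i))"
  have P: "finite P" "\<forall>p\<in>P. prime p"
    by (auto simp: P_def in_prime_factors_iff)
  have "\<bar>int (multiplicity p (w i))\<bar> \<le> int A" if "i \<in> {..<n}" "p \<in> P" for i p
  proof -
    have "2 ^ multiplicity p (w i) \<le> p ^ multiplicity p (w i)"
      using P(2) that prime_ge_2_nat by (intro power_mono) auto
    also have "\<dots> \<le> w i"
      using wpos[of i] that by (intro dvd_imp_le multiplicity_dvd) auto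
    also have "\<dots> \<le> 2 ^ A"
      using assms(4)[of i] that by (auto simp: w_def nat_le_iff)
    finally show ?thesis by simp
  qed
  note mult_le = this
  have "\<exists>k. (\<exists>i\<in>{..<n}. k i \<noteq> 0) \<and>
      (\<forall>p\<in>P. (\<Sum>i<n. k i * int (multiplicity p (w i))) = 0) \<and>
      (\<forall>i\<in>{..<n}. \<bar>k i\<bar> \<le> (int n * int A) ^ (2 ^ card {..<n} - 1))"
    by (rule bounded_relation[where k = k])
      (use mult_le assms(2,3) k(1) P multiplicity_rel[OF wpos k(2)] in auto)
  then obtain k' where k': "\<exists>i<n. k' i \<noteq> 0" "\<forall>p\<in>P. (\<Sum>i<n. k' i * int (multiplicity p (w i))) = 0"
    "\<forall>i<n. \<bar>k' i\<bar> \<le> (int n * int A) ^ (2 ^ n - 1)"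
    by auto
  have "(\<Sum>i<n. of_int (k' i) * ln (real (w i))) =
      (\<Sum>i<n. of_int (k' i) * (\<Sum>p\<in>P. real (multiplicity p (w i)) * ln (real p)))"
    using P wpos by (intro sum.cong refl arg_cong2[where f = times] ln_eq_sum_multiplicity) (auto simp: P_def)
  also have "\<dots> = (\<Sum>p\<in>P. \<Sum>i<n. of_int (k' i) * (real (multiplicity p (w i)) * ln (real p)))"
    by (simp only: sum_distrib_left) (rule sum.swap)
  also have "\<dots> = (\<Sum>p\<in>P. of_int (\<Sum>i<n. k' i * int (multiplicity p (w i))) * ln (real p))"
    by (simp add: sum_distrib_right mult.assoc)
  also have "\<dots> = 0"
    using k'(2) by (intro sum.neutral) simp
  finally show ?thesis
    using k' unfolding w by blast
qed

section \<open>Points far from every dependent vector\<close>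

lemma abs_ln_one_plus_le:
  assumes "\<bar>z::real\<bar> \<le> 1 / 2"
  shows "\<bar>ln (1 + z)\<bar> \<le> 2 * \<bar>z\<bar>"
proof -
  have "\<bar>ln (1 + z) - z\<bar> \<le> 2 * z\<^sup>2"
    using abs_ln_one_plus_x_minus_x_bound assms by blast
  also have "\<dots> = 2 * \<bar>z\<bar> * \<bar>z\<bar>"
    by (simp add: power2_eq_square)
  also have "\<dots> \<le> 1 * \<bar>z\<bar>"
    using assms by (intro mult_right_mono) auto
  finally show ?thesis by linarith
qed

text \<open>For a dependent \<open>v\<close> too close to the point, the form
  \<open>\<Sum>i<n. of_int (k i) * t i\<close> would be a non-zero multiple of
  \<open>1 / W ^ n\<close>, yet at most half of \<open>1 / W ^ n\<close>. \<open>W\<close> exceeds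
  every coefficient of the small relation by construction.\<close>

lemma rho_ge_explicit:
  fixes n \<tau> :: nat
  assumes n: "2 \<le> n" and \<tau>: "1 \<le> \<tau>" and H: "real n * exp (real \<tau> + 1) \<le> H"
  defines "W \<equiv> (n * (2 * (\<tau> + 2))) ^ (2 ^ n - 1) + 1"
  shows "exp (real \<tau>) / (4 * real n * real W ^ (n + 1)) \<le> rho n H"
proof (rule rho_geI)
  define t where "t = (\<lambda>i. real \<tau> + real W ^ i / real W ^ n)"
  define x where "x = restrict (\<lambda>i. exp (t i)) {..<n}"
  define \<eta> where "\<eta> = 1 / (4 * real n * real W ^ (n + 1))"
  have W: "1 \<le> real W" "1 \<le> W" by (auto simp: W_def)
  have t: "real \<tau> \<le> t i" "t i \<le> real \<tau> + 1" if "i < n" for i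
    using that W power_increasing[of i n "real W"] by (auto simp: t_def divide_simps distrib_right)
  show "x \<in> {..<n} \<rightarrow>\<^sub>E UNIV" by (simp add: x_def)
  have "L2_set x {..<n} \<le> (\<Sum>i<n. \<bar>x i\<bar>)" by (rule L2_set_le_sum_abs)
  also have "\<dots> \<le> (\<Sum>i<n. exp (real \<tau> + 1))"
    using t by (intro sum_mono) (auto simp: x_def)
  also have "\<dots> \<le> H" using H by simp
  finally show "L2_set x {..<n} \<le> H" .
  fix v assume v: "v \<in> mult_dep n"
  define d where "d = L2_set (\<lambda>i. x i - real_of_int (v i)) {..<n}"
  have "exp (real \<tau>) * \<eta> \<le> d"
  proof (rule ccontr)
    assume less: "\<not> ?thesis"
    have "1 * 1 \<le> real n * real W ^ (n + 1)"
      using n W by (intro mult_mono one_le_power) auto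
    then have D: "4 \<le> 4 * real n * real W ^ (n + 1)" (is "_ \<le> ?D")
      by (simp only: mult.assoc)
    then have "0 < ?D" by linarith
    then have \<eta>: "0 < \<eta>" "\<eta> \<le> 1 / 4"
      unfolding \<eta>_def using D frac_le[of 1 1 4 ?D] by (simp_all only: zero_less_divide_1_iff)
    have close: "\<exists>z. \<bar>z\<bar> \<le> \<eta> \<and> real_of_int (v i) = exp (t i) * (1 + z)" if i: "i < n" for i
    proof -
      have "\<bar>x i - real_of_int (v i)\<bar> \<le> d"
        unfolding d_def using abs_le_L2_set[of "{..<n}" i "\<lambda>i. x i - real_of_int (v i)"] i by simp
      also have "\<dots> \<le> exp (real \<tau>) * \<eta>" using less by simp
      also have "\<dots> \<le> exp (t i) * \<eta>" using t(1)[OF i] \<eta> by (intro mult_right_mono) auto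
      finally have "\<bar>exp (t i) - real_of_int (v i)\<bar> \<le> exp (t i) * \<eta>"
        using i by (simp add: x_def)
      then have "\<bar>real_of_int (v i) - exp (t i)\<bar> / exp (t i) \<le> \<eta>"
        by (simp add: divide_simps abs_minus_commute mult.commute)
      then show ?thesis
        by (intro exI[of _ "(real_of_int (v i) - exp (t i)) / exp (t i)"])
          (simp add: abs_divide field_simps)
    qed
    have v_le: "\<bar>v i\<bar> \<le> 2 ^ (2 * (\<tau> + 2))" and
      ln_v: "\<bar>t i - ln \<bar>real_of_int (v i)\<bar>\<bar> \<le> 2 * \<eta>" if i: "i < n" for i
    proof -
      obtain z where z: "\<bar>z\<bar> \<le> \<eta>" "real_of_int (v i) = exp (t i) * (1 + z)"
        using close[OF i] by blast
      have z1: "0 < 1 + z" "1 + z \<le> 2" "\<bar>z\<bar> \<le> 1 / 2"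
        using z(1) \<eta> by linarith+
      have "\<bar>real_of_int (v i)\<bar> = exp (t i) * (1 + z)"
        using z z1 by (simp add: abs_mult)
      also have "\<dots> \<le> exp (real \<tau> + 1) * exp 1"
        using t[OF i] z1 exp_ge_add_one_self[of 1] by (intro mult_mono) auto
      also have "\<dots> = exp 1 ^ (\<tau> + 2)"
        by (simp flip: exp_add exp_of_nat_mult)
      also have "\<dots> \<le> 4 ^ (\<tau> + 2)"
        using exp_le by (intro power_mono) auto
      also have "(4::real) ^ (\<tau> + 2) = of_int (2 ^ (2 * (\<tau> + 2)))"
        by (subst power_mult) simp
      finally show "\<bar>v i\<bar> \<le> 2 ^ (2 * (\<tau> + 2))"
        by (simp only: of_int_abs[symmetric] of_int_le_iff)
      have "ln \<bar>real_of_int (v i)\<bar> = t i + ln (1 + z)"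
        using z z1 by (simp add: abs_mult ln_mult)
      then show "\<bar>t i - ln \<bar>real_of_int (v i)\<bar>\<bar> \<le> 2 * \<eta>"
        using abs_ln_one_plus_le[OF z1(3)] z(1) by simp
    qed
    obtain k :: "nat \<Rightarrow> int" where k: "\<exists>i<n. k i \<noteq> 0"
      "(\<Sum>i<n. of_int (k i) * ln \<bar>real_of_int (v i)\<bar>) = 0"
      "\<forall>i<n. \<bar>k i\<bar> \<le> (int n * int (2 * (\<tau> + 2))) ^ (2 ^ n - 1)"
      using mult_dep_bounded_relation[OF v n, of "2 * (\<tau> + 2)"] v_le by auto
    have kW: "\<bar>k i\<bar> < int W" if "i < n" for i
    proof -
      have "int W = (int n * int (2 * (\<tau> + 2))) ^ (2 ^ n - 1) + 1"
        unfolding W_def of_nat_add of_nat_mult of_nat_power of_nat_1 ..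
      then show ?thesis
        using spec[OF k(3), of i] that by linarith
    qed
    \<comment> \<open>\<open>Z\<close> is the linear form in the \<open>t i\<close> multiplied by
      \<open>W ^ n\<close>; it is an integer because \<open>\<tau>\<close> is one.\<close>
    define Z where "Z = int \<tau> * int W ^ n * (\<Sum>i<n. k i) + (\<Sum>i<n. k i * int W ^ i)"
    \<comment> \<open>If the coefficients sum to zero, only the base-\<open>W\<close> expansion
      remains. Otherwise the term with \<open>\<tau>\<close> has size at least \<open>W ^ n\<close>
      and dominates that expansion.\<close>
    have "Z \<noteq> 0"
    proof (cases "(\<Sum>i<n. k i) = 0")
      case True
      then have Z: "Z = (\<Sum>i<n. k i * int W ^ i)"
        by (simp add: Z_def)
      obtain i where "i < n" "k i \<noteq> 0"
        using k(1) by blast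
      then show ?thesis
        unfolding Z using digit_sum_eq_0D[of n k "int W", OF kW] by blast
    next
      case False
      have "1 * 1 \<le> int \<tau> * \<bar>\<Sum>i<n. k i\<bar>"
        using \<tau> False by (intro mult_mono) linarith+
      then have "int W ^ n * 1 \<le> int W ^ n * (int \<tau> * \<bar>\<Sum>i<n. k i\<bar>)"
        by (intro mult_left_mono) auto
      also have "\<dots> = \<bar>int \<tau> * int W ^ n * (\<Sum>i<n. k i)\<bar>"
        by (simp add: abs_mult)
      finally show ?thesis
        using abs_digit_sum_less[of n k "int W", OF kW] unfolding Z_def by linarith
    qed
    have "(\<Sum>i<n. of_int (k i) * t i) * real W ^ n = of_int Z"
      using W by (simp add: Z_def t_def sum_distrib_left sum_distrib_right sum.distrib algebra_simps)
    then have "\<bar>\<Sum>i<n. of_int (k i) * t i\<bar> * real W ^ n = \<bar>of_int Z\<bar>"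
      using W by (metis abs_mult abs_of_nonneg of_nat_0_le_iff zero_le_power)
    moreover have "1 \<le> \<bar>real_of_int Z\<bar>"
      using \<open>Z \<noteq> 0\<close> by linarith
    moreover have "\<bar>\<Sum>i<n. of_int (k i) * t i\<bar> \<le> real n * (real W * (2 * \<eta>))"
    proof -
      \<comment> \<open>The relation allows each \<open>t i\<close> to be replaced by its small
        distance to the logarithm of the coordinate.\<close>
      have "(\<Sum>i<n. of_int (k i) * t i) =
          (\<Sum>i<n. of_int (k i) * (t i - ln \<bar>real_of_int (v i)\<bar>))"
        using k(2) by (simp add: right_diff_distrib sum_subtractf)
      also have "\<bar>\<dots>\<bar> \<le> (\<Sum>i<n. real W * (2 * \<eta>))"
      proof (intro order.trans[OF sum_abs] sum_mono)
        fix i assume i: "i \<in> {..<n}"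
        have "\<bar>real_of_int (k i)\<bar> \<le> real W"
          using kW[of i] i by (metis lessThan_iff less_imp_le of_int_abs of_int_le_iff of_int_of_nat_eq)
        then show "\<bar>of_int (k i) * (t i - ln \<bar>real_of_int (v i)\<bar>)\<bar> \<le> real W * (2 * \<eta>)"
          unfolding abs_mult using ln_v[of i] i by (intro mult_mono) auto
      qed
      also have "\<dots> = real n * (real W * (2 * \<eta>))"
        by simp
      finally show ?thesis .
    qed
    moreover have "real n * (real W * (2 * \<eta>)) * real W ^ n = 1 / 2"
      using n W by (simp add: \<eta>_def field_simps)
    ultimately show False
      using W mult_right_mono[of "\<bar>\<Sum>i<n. of_int (k i) * t i\<bar>" "real n * (real W * (2 * \<eta>))" "real W ^ n"]
      by simp
  qed
  then show "exp (real \<tau>) / (4 * real n * real W ^ (n + 1)) \<le>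
      L2_set (\<lambda>i. x i - real_of_int (v i)) {..<n}"
    by (simp add: d_def \<eta>_def)
qed (use n in simp)

lemma rho_lower_eventually:
  assumes n: "2 \<le> n"
  shows "\<exists>c>0. \<forall>H\<ge>real n * exp 2. H / ln H powr (4 ^ n) \<le> c * rho n H"
proof (intro exI conjI allI impI)
  \<comment> \<open>One factor \<open>4 * real n\<close> comes from the explicit bound,
    \<open>real n * exp 2\<close> from comparing \<open>H\<close> with
    \<open>exp (real \<tau>)\<close>, and the last factor from replacing \<open>q\<close> by
    \<open>L\<close>.\<close>
  define c where "c = 4 * real n ^ 2 * exp 2 * (6 * real n) ^ (4 ^ n)"
  show "0 < c" using n by (simp add: c_def)
  fix H assume H: "real n * exp 2 \<le> H"
  define s where "s = ln (H / real n)"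
  \<comment> \<open>Subtracting 1 leaves room for \<open>exp (real \<tau> + 1)\<close> inside the
    ball; as \<open>2 \<le> s\<close>, the result is still at least 1.\<close>
  define \<tau> where "\<tau> = nat \<lfloor>s\<rfloor> - 1"
  define L where "L = ln H"
  define q where "q = 6 * real n * L"
  define W where "W = (n * (2 * (\<tau> + 2))) ^ (2 ^ n - 1) + 1"
  have "0 < real n * exp 2" using n by simp
  then have H0: "0 < H" using H by linarith
  have Hs: "H = real n * exp s" using H0 n by (simp add: s_def)
  then have s2: "2 \<le> s" using H n by simp
  have \<tau>: "1 \<le> \<tau>" "real \<tau> + 1 \<le> s" "s < real \<tau> + 2"
    using s2 unfolding \<tau>_def by linarith+
  have sL: "s \<le> L"
    using H0 n by (simp add: s_def L_def ln_div)
  have q2: "2 \<le> q"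
  proof -
    have "1 * 1 \<le> real n * L"
      using n sL s2 by (intro mult_mono) auto
    then show ?thesis unfolding q_def mult.assoc by linarith
  qed
  have "real W \<le> q ^ (2 ^ n - 1) + 1"
  proof -
    have "real (n * (2 * (\<tau> + 2))) \<le> q"
    proof -
      have "real n * (2 * (real \<tau> + 2)) \<le> real n * (6 * L)"
        using \<tau> sL by (intro mult_left_mono) auto
      then show ?thesis by (simp add: q_def algebra_simps)
    qed
    then have "real (n * (2 * (\<tau> + 2))) ^ (2 ^ n - 1) \<le> q ^ (2 ^ n - 1)"
      by (rule power_mono) simp
    then show ?thesis by (simp add: W_def)
  qed
  also have "\<dots> \<le> q ^ (2 ^ n - 1) * q"
    using one_le_power[of q "2 ^ n - 1"] q2 mult_left_mono[of 2 q "q ^ (2 ^ n - 1)"] by linarith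
  also have "\<dots> = q ^ (2 ^ n)"
    by (metis Suc_diff_1 mult.commute pos2 power_Suc zero_less_power)
  finally have "real W ^ (n + 1) \<le> (q ^ (2 ^ n)) ^ (n + 1)"
    by (rule power_mono) simp
  also have "\<dots> = q ^ (2 ^ n * (n + 1))"
    by (simp only: power_mult)
  also have "\<dots> \<le> q ^ (4 ^ n)"
  proof (rule power_increasing)
    \<comment> \<open>This turns the exponent \<open>2 ^ n * (n + 1)\<close> into
      \<open>4 ^ n\<close>.\<close>
    have "n + 1 \<le> 2 ^ n"
      using less_exp[of n] by (simp add: Suc_le_eq)
    then have "2 ^ n * (n + 1) \<le> 2 ^ n * 2 ^ n" by (rule mult_left_mono) simp
    also have "\<dots> = 4 ^ n" by (simp flip: power_mult_distrib)
    finally show "2 ^ n * (n + 1) \<le> 4 ^ n" .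
  qed (use q2 in simp)
  finally have W: "real W ^ (n + 1) \<le> q ^ (4 ^ n)" .
  have "exp (real \<tau>) / (4 * real n * q ^ (4 ^ n)) \<le> exp (real \<tau>) / (4 * real n * real W ^ (n + 1))"
  proof -
    have "0 < W" by (simp add: W_def)
    then have "0 < q ^ (4 ^ n)" "0 < real W ^ (n + 1)"
      using q2 by auto
    then show ?thesis
      using W n by (intro divide_left_mono mult_left_mono mult_pos_pos) auto
  qed
  also have "\<dots> \<le> rho n H"
    unfolding W_def using \<tau> n Hs by (intro rho_ge_explicit) auto
  finally have 1: "exp (real \<tau>) / (4 * real n * q ^ (4 ^ n)) \<le> rho n H" .
  have "H \<le> real n * (exp 2 * exp (real \<tau>))"
    unfolding Hs exp_add[symmetric] using \<tau> n by simp
  then have "H / L ^ (4 ^ n) \<le> real n * (exp 2 * exp (real \<tau>)) / L ^ (4 ^ n)"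
    using sL s2 by (intro divide_right_mono) auto
  also have "\<dots> = c * (exp (real \<tau>) / (4 * real n * q ^ (4 ^ n)))"
    using sL s2 n by (simp add: c_def q_def power_mult_distrib power2_eq_square)
  also have "\<dots> \<le> c * rho n H"
    using 1 \<open>0 < c\<close> by (intro mult_left_mono) auto
  also have "L ^ (4 ^ n) = ln H powr (4 ^ n)"
    using sL s2 powr_realpow[of "ln H" "4 ^ n"] by (simp add: L_def)
  finally show "H / ln H powr (4 ^ n) \<le> c * rho n H" .
qed

section \<open>Upper bound\<close>

text \<open>Stop just before the first power of \<open>u\<close> that carries \<open>z\<close>
  beyond \<open>y\<close>; this happens within \<open>N\<close> steps because
  \<open>z * u ^ N\<close> is already beyond \<open>y\<close>.\<close>

lemma greedy_step:
  fixes u w y z :: real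
  assumes "0 < z" "z \<le> y" "y < z * w" "w \<le> u ^ N"
  shows "\<exists>e\<le>N. z * u ^ e \<le> y \<and> y < z * u ^ e * u"
proof -
  have "z * w \<le> z * u ^ N" using assms by simp
  then have "y < z * u ^ N" using assms by linarith
  then obtain e where "e < N" "\<forall>i\<le>e. \<not> y < z * u ^ i" "y < z * u ^ (e + 1)"
    using ex_least_nat_less[of "\<lambda>e. y < z * u ^ e" N] assms(2) by auto
  then show ?thesis
    by (intro exI[of _ e]) (auto simp: not_less mult_ac)
qed

text \<open>The generators \<open>b j = M ^ m + K * M ^ (m - j)\<close> are \<open>a = M ^ m\<close> times \<open>1 + K / M ^ j\<close>.
  Greedily multiplying \<open>a ^ r\<close> by these ratios for \<open>j = 1, 2, \<dots>, m\<close> takes \<open>O(M)\<close> steps at each level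
  and divides the relative error by \<open>M\<close> from one level to the next.\<close>

lemma smooth_approx:
  fixes M K m :: nat and b :: "nat \<Rightarrow> nat" and y H :: real
  assumes m: "1 \<le> m" and K: "1 \<le> K" "K \<le> M" "ln (real M) \<le> real K" and M: "2 \<le> M"
    and b: "b 0 = M ^ m" "\<And>j. 1 \<le> j \<Longrightarrow> j \<le> m \<Longrightarrow> b j = M ^ m + K * M ^ (m - j)"
    and y: "0 \<le> y" "y \<le> H"
  shows "\<exists>e. \<bar>y - real (\<Prod>j\<le>m. b j ^ e j)\<bar> \<le>
    H * (real K / real M ^ m) + exp (real (3 * m ^ 2 * M * K))"
proof -
  define a where "a = real M ^ m"
  define u where "u = (\<lambda>j. 1 + real K / real M ^ j)"
  \<comment> \<open>Level 1 uses at most \<open>2 * m * M\<close> ratios and each of the other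
    \<open>m - 1\<close> levels at most \<open>M\<close>, so \<open>T\<close> bounds their total
    number.\<close>
  define T where "T = 3 * m * M"
  have a: "1 < a" using M m by (simp add: a_def)
  have ln_a: "a \<le> exp (real (m * K))"
  proof -
    have "a = exp (ln (real M)) ^ m" using M by (simp add: a_def)
    also have "\<dots> \<le> exp (real K) ^ m"
      using K(3) by (intro power_mono) (simp_all only: exp_le_cancel_iff exp_ge_zero)
    finally show ?thesis by (simp flip: exp_of_nat_mult)
  qed
  have err0: "0 \<le> H * (real K / real M ^ m)" using y by simp
  show ?thesis
  proof (cases "y < a ^ T")
    \<comment> \<open>Here the empty product 1 suffices: both it and \<open>y\<close> are at most
      \<open>a ^ T\<close>, which the exponential error term covers.\<close>
    case True
    have "a ^ T \<le> exp (real (m * K)) ^ T"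
      using ln_a a by (intro power_mono) auto
    also have "\<dots> = exp (real (3 * m ^ 2 * M * K))"
      by (simp add: T_def power2_eq_square algebra_simps flip: exp_of_nat_mult)
    finally have "a ^ T \<le> exp (real (3 * m ^ 2 * M * K))" .
    moreover have "1 \<le> a ^ T" using a by (simp add: one_le_power)
    ultimately have "\<bar>y - 1\<bar> \<le> exp (real (3 * m ^ 2 * M * K))"
      using True y by linarith
    then show ?thesis
      using err0 by (intro exI[of _ "\<lambda>_. 0"]) simp
  next
    case False
    then have y1: "1 \<le> y" using one_le_power[of a T] a by linarith
    obtain N where "y < a ^ N" using real_arch_pow[OF a] by blast
    then obtain r where r: "a ^ r \<le> y" "y < a ^ r * a"
      using greedy_step[of 1 y "a ^ N" a N] y1 by auto
    have "T \<le> r"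
    proof (rule ccontr)
      assume "\<not> T \<le> r"
      then have "a ^ (r + 1) \<le> a ^ T" using a by (intro power_increasing) auto
      then show False using r False by (simp add: mult.commute)
    qed
    have u1: "1 < u j" for j using K M by (simp add: u_def)
    have level: "\<exists>e. (\<Sum>i\<in>{1..j}. e i) \<le> 2 * m * M + (j - 1) * M \<and>
        a ^ r * (\<Prod>i\<in>{1..j}. u i ^ e i) \<le> y \<and> y < a ^ r * (\<Prod>i\<in>{1..j}. u i ^ e i) * u j"
      if "1 \<le> j" for j
      using that
    proof (induction j rule: dec_induct)
      case base
      \<comment> \<open>This is \<open>exp x \<le> 1 + 2 * x\<close> for
        \<open>x \<le> 1 / 2\<close>, where \<open>K \<le> M\<close> enters. It shows that
        \<open>2 * m * M\<close> factors \<open>u 1\<close> span a whole factor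
        \<open>a\<close>.\<close>
      have "exp (real K / (2 * real M)) \<le> u 1"
        using exp_bound_lemma[of "real K / (2 * real M)"] K M by (simp add: u_def divide_simps)
      then have "exp (real K / (2 * real M)) ^ (2 * m * M) \<le> u 1 ^ (2 * m * M)"
        by (rule power_mono) simp
      moreover have "exp (real K / (2 * real M)) ^ (2 * m * M) = exp (real (m * K))"
        using M by (simp flip: exp_of_nat_mult)
      ultimately have "a \<le> u 1 ^ (2 * m * M)" using ln_a by linarith
      then obtain e where "e \<le> 2 * m * M" "a ^ r * u 1 ^ e \<le> y" "y < a ^ r * u 1 ^ e * u 1"
        using greedy_step[of "a ^ r" y a "u 1" "2 * m * M"] r a by auto
      then show ?case by (intro exI[of _ "\<lambda>_. e"]) simp
    next
      case (step j)
      then obtain e where e: "(\<Sum>i\<in>{1..j}. e i) \<le> 2 * m * M + (j - 1) * M"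
        "a ^ r * (\<Prod>i\<in>{1..j}. u i ^ e i) \<le> y" "y < a ^ r * (\<Prod>i\<in>{1..j}. u i ^ e i) * u j"
        by blast
      \<comment> \<open>By Bernoulli's inequality, \<open>M\<close> ratios of the next level cover
        one ratio of the current level.\<close>
      have "1 + real M * (real K / real M ^ Suc j) \<le> u (Suc j) ^ M"
        unfolding u_def using K M by (intro Bernoulli_inequality) (auto intro: order_trans[of _ 0])
      then have "u j \<le> u (Suc j) ^ M" using M by (simp add: u_def)
      moreover have "0 < a ^ r * (\<Prod>i\<in>{1..j}. u i ^ e i)"
        using a u1 by (intro mult_pos_pos prod_pos zero_less_power) (auto intro: less_trans[of _ 1])
      ultimately obtain f where f: "f \<le> M" "a ^ r * (\<Prod>i\<in>{1..j}. u i ^ e i) * u (Suc j) ^ f \<le> y"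
        "y < a ^ r * (\<Prod>i\<in>{1..j}. u i ^ e i) * u (Suc j) ^ f * u (Suc j)"
        using greedy_step[of "a ^ r * (\<Prod>i\<in>{1..j}. u i ^ e i)" y "u j" "u (Suc j)" M] e by auto
      define e' where "e' = e(Suc j := f)"
      have "(\<Prod>i\<in>{1..Suc j}. u i ^ e' i) = (\<Prod>i\<in>{1..j}. u i ^ e i) * u (Suc j) ^ f"
        using step.hyps by (simp add: e'_def)
      moreover have "(\<Sum>i\<in>{1..Suc j}. e' i) = (\<Sum>i\<in>{1..j}. e i) + f"
        using step.hyps by (simp add: e'_def)
      moreover have "2 * m * M + (j - 1) * M + M = 2 * m * M + (Suc j - 1) * M"
        using step.hyps by (cases j) auto
      ultimately show ?case
        using e(1) f by (intro exI[of _ e']) (auto simp: mult.assoc)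
    qed
    obtain e where e: "(\<Sum>i\<in>{1..m}. e i) \<le> 2 * m * M + (m - 1) * M"
      "a ^ r * (\<Prod>i\<in>{1..m}. u i ^ e i) \<le> y" "y < a ^ r * (\<Prod>i\<in>{1..m}. u i ^ e i) * u m"
      using level[OF m] by blast
    define s where "s = (\<Sum>i\<in>{1..m}. e i)"
    have "(m - 1) * M \<le> m * M" by simp
    then have "s \<le> r"
      using e(1) \<open>T \<le> r\<close> unfolding s_def T_def by linarith
    \<comment> \<open>Each \<open>b j\<close> with \<open>1 \<le> j\<close> brings a factor
      \<open>a\<close> of its own. These use up \<open>s\<close> of the \<open>r\<close> factors,
      and the remaining ones are supplied by \<open>b 0\<close>.\<close>
    define e' where "e' = e(0 := r - s)"
    define v where "v = (\<Prod>j\<le>m. b j ^ e' j)"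
    have bu: "real (b j) = a * u j" if "j \<in> {1..m}" for j
    proof -
      have "real M ^ (m - j) = real M ^ m / real M ^ j"
        using that M by (intro power_diff) auto
      then show ?thesis
        using that b(2)[of j] by (simp add: a_def u_def distrib_left)
    qed
    have "real v = real (b 0) ^ e' 0 * (\<Prod>j\<in>{1..m}. real (b j) ^ e' j)"
    proof -
      have "{..m} = insert 0 {1..m}" by auto
      then show ?thesis by (simp add: v_def)
    qed
    also have "\<dots> = a ^ (r - s) * (\<Prod>j\<in>{1..m}. (a * u j) ^ e j)"
      using b(1) bu by (simp add: e'_def a_def)
    also have "(\<Prod>j\<in>{1..m}. (a * u j) ^ e j) = a ^ s * (\<Prod>j\<in>{1..m}. u j ^ e j)"
      by (simp add: power_mult_distrib prod.distrib s_def power_sum)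
    also have "a ^ (r - s) * (a ^ s * (\<Prod>j\<in>{1..m}. u j ^ e j)) = a ^ r * (\<Prod>j\<in>{1..m}. u j ^ e j)"
      using \<open>s \<le> r\<close> by (simp flip: mult.assoc power_add)
    finally have v: "real v \<le> y" "y < real v * u m"
      using e by auto
    have "\<bar>y - real v\<bar> \<le> real v * (real K / real M ^ m)"
      using v by (simp add: u_def distrib_left)
    also have "\<dots> \<le> H * (real K / real M ^ m)"
      using v y by (intro mult_right_mono) auto
    finally show ?thesis
      unfolding v_def by (intro exI[of _ e']) (smt (verit) exp_gt_zero)
  qed
qed

text \<open>The \<open>n\<close> exponent vectors have fewer than \<open>n\<close> entries each, so
  they satisfy an integer relation, which is a multiplicative relation between the products.\<close>

lemma mult_depI_products:
  fixes b :: "nat \<Rightarrow> nat" and e :: "nat \<Rightarrow> nat \<Rightarrow> nat"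
  assumes "finite J" "card J < n" "\<And>j. j \<in> J \<Longrightarrow> 0 < b j"
    and v: "v \<in> {..<n} \<rightarrow>\<^sub>E UNIV" "\<And>i. i < n \<Longrightarrow> \<bar>v i\<bar> = int (\<Prod>j\<in>J. b j ^ e i j)"
  shows "v \<in> mult_dep n"
proof -
  have abs_v: "\<bar>real_of_int (v i)\<bar> = (\<Prod>j\<in>J. real (b j) ^ e i j)" if "i < n" for i
  proof -
    have "\<bar>real_of_int (v i)\<bar> = real_of_int (int (\<Prod>j\<in>J. b j ^ e i j))"
      unfolding v(2)[OF that, symmetric] by simp
    then show ?thesis by simp
  qed
  have ln_v: "ln \<bar>real_of_int (v i)\<bar> = (\<Sum>j\<in>J. real (e i j) * ln (real (b j)))" if "i < n" for i
  proof -
    have "ln \<bar>real_of_int (v i)\<bar> = (\<Sum>j\<in>J. ln (real (b j) ^ e i j))"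
      unfolding abs_v[OF that] by (rule ln_prod) (use assms in auto)
    then show ?thesis by (simp add: ln_realpow)
  qed
  have nz: "v i \<noteq> 0" if "i < n" for i
  proof -
    have "0 < (\<Prod>j\<in>J. real (b j) ^ e i j)"
      using assms(3) by (intro prod_pos) simp
    then show ?thesis using abs_v[OF that] by auto
  qed
  obtain k :: "nat \<Rightarrow> int" where k: "\<exists>i\<in>{..<n}. k i \<noteq> 0" "\<forall>j\<in>J. (\<Sum>i<n. k i * int (e i j)) = 0"
    using exists_relation[of J "{..<n}" "\<lambda>i j. int (e i j)"] assms by auto
  have "(\<Sum>i<n. of_int (k i) * ln \<bar>real_of_int (v i)\<bar>) =
      (\<Sum>i<n. \<Sum>j\<in>J. of_int (k i) * (real (e i j) * ln (real (b j))))"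
    by (simp add: ln_v sum_distrib_left)
  also have "\<dots> = (\<Sum>j\<in>J. of_int (\<Sum>i<n. k i * int (e i j)) * ln (real (b j)))"
    by (subst sum.swap) (simp add: sum_distrib_right mult.assoc)
  also have "\<dots> = 0"
    using k(2) by (intro sum.neutral) simp
  finally show ?thesis
    unfolding mult_dep_iff using v(1) nz k(1) by auto
qed

text \<open>All coordinates are approximated in absolute value by products of the same
  \<open>m + 1\<close> generators, one fewer than the dimension, and then given their signs
  back.\<close>

lemma rho_le_explicit:
  fixes M K m :: nat
  assumes m: "1 \<le> m" and K: "1 \<le> K" "K \<le> M" "ln (real M) \<le> real K" and M: "2 \<le> M" and H: "0 \<le> H"
  shows "rho (m + 2) H \<le>
    real (m + 2) * (H * (real K / real M ^ m) + exp (real (3 * m ^ 2 * M * K)))" (is "_ \<le> real ?n * ?d")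
proof (rule rho_leI[OF H])
  fix x assume x: "x \<in> {..<?n} \<rightarrow>\<^sub>E (UNIV :: real set)" "L2_set x {..<?n} \<le> H"
  define b where "b = (\<lambda>j. M ^ m + (if j = 0 then 0 else K * M ^ (m - j)))"
  have "\<exists>e. \<bar>\<bar>x i\<bar> - real (\<Prod>j\<le>m. b j ^ e j)\<bar> \<le> ?d" if "i < ?n" for i
  proof (rule smooth_approx[OF m K M])
    show "\<bar>x i\<bar> \<le> H"
      using abs_le_L2_set[of "{..<?n}" i x] x(2) that by simp
  qed (auto simp: b_def)
  then obtain e where e: "\<And>i. i < ?n \<Longrightarrow> \<bar>\<bar>x i\<bar> - real (\<Prod>j\<le>m. b j ^ e i j)\<bar> \<le> ?d"
    by metis
  define v where "v = restrict (\<lambda>i. (if x i < 0 then - 1 else 1) * int (\<Prod>j\<le>m. b j ^ e i j)) {..<?n}"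
  have "v \<in> mult_dep ?n"
  proof (rule mult_depI_products[of "{..m}" ?n b v e])
    show "\<bar>v i\<bar> = int (\<Prod>j\<le>m. b j ^ e i j)" if "i < ?n" for i
      using that by (simp add: v_def abs_mult abs_prod)
  qed (use M in \<open>auto simp: v_def b_def\<close>)
  moreover have "L2_set (\<lambda>i. x i - real_of_int (v i)) {..<?n} \<le> real ?n * ?d"
  proof -
    have sgn_dist: "\<bar>y - (if y < 0 then - 1 else 1) * p\<bar> = \<bar>\<bar>y\<bar> - p\<bar>" for y p :: real
      by (cases "y < 0") auto
    have "\<bar>x i - real_of_int (v i)\<bar> \<le> ?d" if "i < ?n" for i
    proof -
      have "real_of_int (v i) = (if x i < 0 then - 1 else 1) * real (\<Prod>j\<le>m. b j ^ e i j)"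
        using that by (simp add: v_def)
      then show ?thesis
        using e[OF that] sgn_dist[of "x i"] by (simp only:)
    qed
    then have "(\<Sum>i<?n. \<bar>x i - real_of_int (v i)\<bar>) \<le> (\<Sum>i<?n. ?d)"
      by (intro sum_mono) simp
    then show ?thesis
      using L2_set_le_sum_abs[of "\<lambda>i. x i - real_of_int (v i)" "{..<?n}"] by simp
  qed
  ultimately show "\<exists>v\<in>mult_dep ?n. L2_set (\<lambda>i. x i - real_of_int (v i)) {..<?n} \<le> real ?n * ?d"
    by blast
qed

section \<open>Choice of the parameters for large \<open>H\<close>\<close>

lemma eventually_ln_power2_le:
  assumes "0 < (c::real)"
  shows "eventually (\<lambda>x. c * ln x ^ 2 \<le> x) at_top"
proof -
  have "((\<lambda>x::real. ln x ^ 2 / exp (ln x)) \<longlongrightarrow> 0) at_top"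
    by (rule filterlim_compose[OF tendsto_power_div_exp_0 ln_at_top])
  then have "eventually (\<lambda>x. ln x ^ 2 / exp (ln x) < 1 / c) at_top"
    using assms by (intro order_tendstoD(2)) auto
  then show ?thesis
    using eventually_gt_at_top[of 0]
    by eventually_elim (use assms in \<open>simp add: field_simps\<close>)
qed

lemma eventually_power_le_exp_half: "eventually (\<lambda>x::real. x ^ m \<le> exp (x / 2)) at_top"
proof -
  have "((\<lambda>x::real. (x / 2) ^ m / exp (x / 2)) \<longlongrightarrow> 0) at_top"
    by (rule filterlim_compose[OF tendsto_power_div_exp_0])
       (rule filterlim_at_top_mult_tendsto_pos[OF tendsto_const, of "1/2", simplified]; simp add: filterlim_ident)
  then have "eventually (\<lambda>x::real. (x / 2) ^ m / exp (x / 2) < 1 / 2 ^ m) at_top"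
    by (intro order_tendstoD(2)) auto
  then show ?thesis
    by eventually_elim (simp add: field_simps power_divide)
qed

text \<open>With \<open>L = ln H\<close>, the choice \<open>K\<close> about \<open>ln L\<close> and
  \<open>M\<close> about \<open>L / (6 * m ^ 2 * K)\<close> keeps the exponential error below the
  square root of \<open>H\<close>, while \<open>K / M ^ m\<close> has the order
  \<open>ln L ^ (m + 1) / L ^ m\<close>.\<close>

lemma rho_upper_eventually:
  assumes m: "1 \<le> m"
  shows "\<exists>c>0. \<exists>H1. \<forall>H\<ge>H1. rho (m + 2) H \<le> c * (H * (ln (ln H) ^ (m + 1) / ln H ^ m))"
proof -
  have "eventually (\<lambda>L. 1 \<le> ln L \<and> 36 * real m ^ 2 * ln L ^ 2 \<le> L \<and> L ^ m \<le> exp (L / 2)) at_top"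
  proof -
    have "eventually (\<lambda>L. 36 * real m ^ 2 * ln L ^ 2 \<le> L) at_top"
      using m by (intro eventually_ln_power2_le) simp
    with eventually_power_le_exp_half[of m] eventually_ge_at_top[of "exp 1"]
    show ?thesis
    proof eventually_elim
      case (elim L)
      moreover have "0 < L" using elim exp_gt_zero[of "1::real"] by linarith
      ultimately show ?case by (simp add: ln_ge_iff)
    qed
  qed
  then obtain L1 where L1: "\<And>L. L1 \<le> L \<Longrightarrow> 1 \<le> ln L" "\<And>L. L1 \<le> L \<Longrightarrow> 36 * real m ^ 2 * ln L ^ 2 \<le> L"
    "\<And>L. L1 \<le> L \<Longrightarrow> L ^ m \<le> exp (L / 2)"
    unfolding eventually_at_top_linorder by auto
  define c where "c = real (m + 2) * (2 * (24 * real m ^ 2) ^ m + 1)"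
  have "rho (m + 2) H \<le> c * (H * (ln (ln H) ^ (m + 1) / ln H ^ m))" if H: "exp (max L1 1) \<le> H" for H
  proof -
    define L where "L = ln H"
    define l where "l = ln L"
    \<comment> \<open>Rounding up ensures \<open>ln (real M) \<le> real K\<close>, since
      \<open>M\<close> will be at most \<open>L\<close>.\<close>
    define K where "K = nat \<lceil>l\<rceil>"
    \<comment> \<open>This is twice the factor \<open>3 * m ^ 2 * K\<close> in the exponential
      error, so that its exponent is at most \<open>L / 2\<close>.\<close>
    define D where "D = 6 * real m ^ 2 * real K"
    define M where "M = nat \<lfloor>L / D\<rfloor>"
    have H0: "0 < H" using H exp_gt_zero[of "max L1 1"] by linarith
    have "max L1 1 \<le> L" using H ln_ge_iff[OF H0] unfolding L_def by blast
    then have L: "1 \<le> L" "1 \<le> l" "36 * real m ^ 2 * l ^ 2 \<le> L" "L ^ m \<le> exp (L / 2)"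
      using L1[of L] by (auto simp: l_def)
    have K: "1 \<le> K" "l \<le> real K" "real K \<le> 2 * l"
      using L(2) unfolding K_def by linarith+
    have m2: "1 \<le> real m ^ 2" using m by (simp add: one_le_power)
    have D: "1 \<le> D" "0 < D"
    proof -
      have "1 * 1 \<le> real m ^ 2 * real K"
        using m2 K(1) by (intro mult_mono) auto
      then show "1 \<le> D" "0 < D" unfolding D_def mult.assoc by linarith+
    qed
    \<comment> \<open>The constant 36 arises from \<open>real K \<le> 2 * l\<close> and
      \<open>real K + 1 \<le> 3 * l\<close>. The estimate yields \<open>K \<le> M\<close> and
      \<open>2 \<le> M\<close> after rounding down.\<close>
    have D_le: "D * (real K + 1) \<le> L"
    proof -
      have "D * (real K + 1) \<le> (6 * real m ^ 2 * (2 * l)) * (3 * l)"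
        unfolding D_def using K L(2) by (intro mult_mono) auto
      then show ?thesis using L(3) by (simp add: power2_eq_square)
    qed
    then have q: "real K + 1 \<le> L / D" using D by (simp add: field_simps)
    have M: "real M \<le> L / D" "L / D < real M + 1"
      using q unfolding M_def by linarith+
    have KM: "K \<le> M" "1 \<le> M" using q M K(1) by linarith+
    have "L / D < 2 * real M" using M KM by linarith
    then have M_ge: "L / (24 * real m ^ 2 * l) \<le> real M"
    proof -
      \<comment> \<open>The 24 consists of the 6 in \<open>D\<close>, a 2 from rounding
        \<open>K\<close> up and a 2 from rounding \<open>M\<close> down.\<close>
      have "L / (24 * real m ^ 2 * l) \<le> L / (2 * D)"
      proof (rule divide_left_mono)
        have "12 * real m ^ 2 * real K \<le> 12 * real m ^ 2 * (2 * l)"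
          using K(3) by (intro mult_left_mono) auto
        then show *: "2 * D \<le> 24 * real m ^ 2 * l" by (simp add: D_def)
        show "0 < 24 * real m ^ 2 * l * (2 * D)"
          using m D L(2) by simp
      qed (use L in simp)
      then show ?thesis using \<open>L / D < 2 * real M\<close> by simp
    qed
    have "2 \<le> M" using q M K(1) by linarith
    have "real M \<le> L"
    proof -
      have "L / D \<le> L" using D L(1) by (simp add: divide_le_eq mult_le_cancel_left1)
      then show ?thesis using M by linarith
    qed
    then have lnM: "ln (real M) \<le> real K"
      using K(2) KM(2) L(1) ln_le_cancel_iff[of "real M" L] unfolding l_def by linarith
    have pow: "real K / real M ^ m \<le> 2 * (24 * real m ^ 2) ^ m * (l ^ (m + 1) / L ^ m)"
    proof -
      have "real K / real M ^ m \<le> (2 * l) / (L / (24 * real m ^ 2 * l)) ^ m"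
      proof (rule frac_le)
        have "0 < L / (24 * real m ^ 2 * l)" using m L(1,2) by simp
        then show "0 < (L / (24 * real m ^ 2 * l)) ^ m"
          "(L / (24 * real m ^ 2 * l)) ^ m \<le> real M ^ m"
          using M_ge by (simp_all only: zero_less_power power_mono less_imp_le)
      qed (use K L in auto)
      also have "\<dots> = 2 * (24 * real m ^ 2) ^ m * (l ^ (m + 1) / L ^ m)"
        by (simp add: power_divide power_mult_distrib)
      finally show ?thesis .
    qed
    have ex: "exp (real (3 * m ^ 2 * M * K)) \<le> H * (l ^ (m + 1) / L ^ m)"
    proof -
      have "real M * D \<le> L" using M(1) D by (simp add: field_simps)
      then have "real (3 * m ^ 2 * M * K) \<le> L / 2"
        by (simp add: D_def algebra_simps)
      then have "exp (real (3 * m ^ 2 * M * K)) \<le> exp (L / 2)" by simp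
      also have "\<dots> = H / exp (L / 2)"
        using H0 by (simp add: L_def field_simps flip: exp_add)
      also have "\<dots> \<le> H * (1 / L ^ m)"
        using L H0 by (simp add: frac_le)
      also have "\<dots> \<le> H * (l ^ (m + 1) / L ^ m)"
        using L H0 one_le_power[of l "m + 1"] by (intro mult_left_mono divide_right_mono) auto
      finally show ?thesis .
    qed
    have "rho (m + 2) H \<le> real (m + 2) * (H * (real K / real M ^ m) + exp (real (3 * m ^ 2 * M * K)))"
      using m K(1) KM(1) lnM \<open>2 \<le> M\<close> H0 by (intro rho_le_explicit) auto
    also have "\<dots> \<le> real (m + 2) * (H * (2 * (24 * real m ^ 2) ^ m * (l ^ (m + 1) / L ^ m)) + H * (l ^ (m + 1) / L ^ m))"
      using pow ex H0 by (intro mult_left_mono add_mono) auto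
    also have "\<dots> = c * (H * (l ^ (m + 1) / L ^ m))"
      by (simp only: c_def distrib_left distrib_right mult_1_left mult_1_right mult_ac)
    finally show ?thesis by (simp add: l_def L_def)
  qed
  moreover have "0 < c" unfolding c_def by (intro mult_pos_pos add_nonneg_pos) auto
  ultimately show ?thesis by blast
qed

section \<open>Uniformity near the ends of the ranges\<close>

text \<open>Below \<open>real n * exp 2\<close> the left side is at most \<open>d\<close>, because
  \<open>ln H\<close> is at least \<open>ln H\<^sub>0\<close>, while \<open>rho n H\<close> is at
  least 1.\<close>

lemma vinogradov_rho_lower:
  assumes n: "2 \<le> n" and H\<^sub>0: "1 < H\<^sub>0"
  shows "vinogradov_on {H\<^sub>0..} (\<lambda>H. H / ln H powr (4 ^ n)) (\<lambda>H. rho n H)"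
proof -
  obtain c where c: "0 < c" "\<And>H. real n * exp 2 \<le> H \<Longrightarrow> H / ln H powr (4 ^ n) \<le> c * rho n H"
    using rho_lower_eventually[OF n] by blast
  define d where "d = real n * exp 2 / ln H\<^sub>0 powr (4 ^ n)"
  have d: "0 \<le> d" by (simp add: d_def)
  have "\<bar>H / ln H powr (4 ^ n)\<bar> \<le> (c + d) * rho n H" if H: "H\<^sub>0 \<le> H" for H
  proof -
    have r: "1 \<le> rho n H" using n H\<^sub>0 H by (intro one_le_rho) auto
    have ln: "0 < ln H\<^sub>0" "ln H\<^sub>0 \<le> ln H" using H\<^sub>0 H by auto
    have "H / ln H powr (4 ^ n) \<le> (c + d) * rho n H"
    proof (cases "real n * exp 2 \<le> H")
      case True
      have "c * rho n H \<le> (c + d) * rho n H"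
        using r d by (intro mult_right_mono) auto
      then show ?thesis using c(2)[OF True] by linarith
    next
      case False
      have "H / ln H powr (4 ^ n) \<le> d"
        unfolding d_def using False ln H\<^sub>0 H by (intro frac_le powr_mono2) auto
      also have "\<dots> \<le> (c + d) * 1" using c(1) by simp
      also have "\<dots> \<le> (c + d) * rho n H" using r c(1) d by (intro mult_left_mono) auto
      finally show ?thesis .
    qed
    moreover have "0 \<le> H / ln H powr (4 ^ n)" using H\<^sub>0 H by simp
    ultimately show ?thesis by simp
  qed
  moreover have "0 < c + d" using c(1) d by simp
  ultimately show ?thesis unfolding vinogradov_on_def by auto
qed

lemma vinogradov_rho_upper:
  assumes n: "3 \<le> n" and H\<^sub>0: "exp 1 < H\<^sub>0"
  shows "vinogradov_on {H\<^sub>0..} (\<lambda>H. rho n H) (\<lambda>H. H * ((ln (ln H)) ^ (n - 1) / (ln H) ^ (n - 2)))"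
proof -
  define g where "g = (\<lambda>H. (ln (ln H)) ^ (n - 1) / (ln H) ^ (n - 2) :: real)"
  have "\<exists>c>0. \<exists>H1. \<forall>H\<ge>H1. rho n H \<le> c * (H * g H)"
  proof -
    have "1 \<le> n - 2" "n - 2 + 2 = n" "n - 2 + 1 = n - 1" using n by auto
    then show ?thesis using rho_upper_eventually[of "n - 2"] unfolding g_def by simp
  qed
  then obtain c H1 where c: "0 < c" "\<And>H. H1 \<le> H \<Longrightarrow> rho n H \<le> c * (H * g H)"
    by blast
  define H2 where "H2 = max H1 H\<^sub>0"
  \<comment> \<open>On the bounded range, \<open>d\<close> is a positive lower bound for
    \<open>g\<close>: the numerator is smallest at \<open>H\<^sub>0\<close> and the denominator
    largest at \<open>H2\<close>. There the trivial bound for \<open>rho n H\<close>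
    suffices.\<close>
  define d where "d = (ln (ln H\<^sub>0)) ^ (n - 1) / (ln H2) ^ (n - 2)"
  have "(1::real) < exp 1" by simp
  then have H\<^sub>0': "1 < H\<^sub>0" using H\<^sub>0 by linarith
  have "1 < ln H\<^sub>0" using H\<^sub>0 H\<^sub>0' ln_less_cancel_iff[of "exp 1" H\<^sub>0] by simp
  then have ll: "0 < ln (ln H\<^sub>0)" by simp
  have H2: "H\<^sub>0 \<le> H2" "H1 \<le> H2" by (auto simp: H2_def)
  have d: "0 < d"
    unfolding d_def using ll H2 H\<^sub>0' by (intro divide_pos_pos zero_less_power) auto
  have "\<bar>rho n H\<bar> \<le> (c + real (n + 1) / d) * (H * g H)" if H: "H\<^sub>0 \<le> H" for H
  proof -
    have H1: "1 < H" using H H\<^sub>0' by simp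
    have lnH: "ln H\<^sub>0 \<le> ln H" using H H\<^sub>0' by simp
    then have llH: "ln (ln H\<^sub>0) \<le> ln (ln H)" using \<open>1 < ln H\<^sub>0\<close> by simp
    have g0: "0 \<le> H * g H"
      unfolding g_def using llH ll H1 lnH \<open>1 < ln H\<^sub>0\<close>
      by (intro mult_nonneg_nonneg divide_nonneg_nonneg zero_le_power) auto
    have "rho n H \<le> (c + real (n + 1) / d) * (H * g H)"
    proof (cases "H2 \<le> H")
      case True
      have "c * (H * g H) \<le> (c + real (n + 1) / d) * (H * g H)"
        using d g0 by (intro mult_right_mono) auto
      then show ?thesis using c(2)[of H] True H2 by linarith
    next
      case False
      have "d \<le> g H"
        unfolding d_def g_def using False ll llH H1 lnH \<open>1 < ln H\<^sub>0\<close>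
          by (intro frac_le power_mono zero_le_power zero_less_power) auto
      have "rho n H \<le> H + real n" using n H1 by (intro rho_le_trivial) auto
      also have "\<dots> \<le> real (n + 1) * H"
        using H1 mult_left_mono[of 1 H "real n"] by (simp add: distrib_right)
      also have "\<dots> = real (n + 1) / d * (H * d)" using d by simp
      also have "\<dots> \<le> real (n + 1) / d * (H * g H)"
        using \<open>d \<le> g H\<close> d H1 by (intro mult_left_mono) auto
      also have "\<dots> \<le> (c + real (n + 1) / d) * (H * g H)"
        using c(1) g0 by (intro mult_right_mono) auto
      finally show ?thesis .
    qed
    moreover have "1 \<le> rho n H" using n H1 by (intro one_le_rho) auto
    ultimately show ?thesis by simp
  qed
  moreover have "0 < c + real (n + 1) / d" using c(1) d by (intro add_pos_nonneg) auto
  ultimately show ?thesis unfolding vinogradov_on_def g_def by auto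
qed

lemma vinogradov_rho_2:
  "vinogradov_on {1<..} (\<lambda>H. H) (\<lambda>H. rho 2 H)" "vinogradov_on {1<..} (\<lambda>H. rho 2 H) (\<lambda>H. H)"
proof -
  have "\<bar>H\<bar> \<le> 32 * rho 2 H" if "1 < H" for H
    using rho_2_ge[of H] one_le_rho[of 2 H] that by (cases "8 \<le> H") auto
  then show "vinogradov_on {1<..} (\<lambda>H. H) (\<lambda>H. rho 2 H)"
    unfolding vinogradov_on_def by (intro exI[of _ 32]) auto
  have "\<bar>rho 2 H\<bar> \<le> 3 * H" if "1 < H" for H
    using rho_le_trivial[of 2 H] one_le_rho[of 2 H] that by auto
  then show "vinogradov_on {1<..} (\<lambda>H. rho 2 H) (\<lambda>H. H)"
    unfolding vinogradov_on_def by (intro exI[of _ 3]) auto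
qed

theorem theorem1p7:
  shows "vinogradov_on {1<..} (\<lambda>H. H) (\<lambda>H. rho 2 H) \<and>
         vinogradov_on {1<..} (\<lambda>H. rho 2 H) (\<lambda>H. H) \<and>
         (\<exists>C\<^sub>0 :: nat \<Rightarrow> real. effectively_computable C\<^sub>0 \<and>
            (\<forall>n\<ge>3. C\<^sub>0 n > 0 \<and>
               (\<forall>H\<^sub>0>1. vinogradov_on {H\<^sub>0..}
                  (\<lambda>H. H / (ln H) powr (C\<^sub>0 n)) (\<lambda>H. rho n H)) \<and>
               (\<forall>H\<^sub>0>exp 1. vinogradov_on {H\<^sub>0..}
                  (\<lambda>H. rho n H) (\<lambda>H. H * ((ln (ln H)) ^ (n - 1) / (ln H) ^ (n - 2))))))"
  using vinogradov_rho_2 effectively_computable_pow4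
  by (intro conjI exI[of _ "\<lambda>n. 4 ^ n"] allI impI vinogradov_rho_lower vinogradov_rho_upper) auto

end
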